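(* Let $A$ be a set of $n$ actions, let $f:2^A\to\mathbb{R}_{\ge 0}$ be a monotone Ultra reward function (accessed via value queries) and let $c:2^A\to\mathbb{R}_{\ge 0}$ be an additive cost function. Then the optimal contract problem for $(f,c)$ can be solved in polynomial time using value queries: there is an algorithm, running in time polynomial in $n$, that outputs a contract $\alpha\in[0,1]$ maximizing the principal's utility $u_p(\alpha)=(1-\alpha)f(S_\alpha)$.
   Context: $A$ is a finite set of $n$ actions. A reward function $f$ and a cost function $c$ are monotone set functions ($S\subseteq T$ implies $f(S)\le f(T)$, $c(S)\le c(T)$) with $f(\emptyset)=c(\emptyset)=0$ (in the model $f$ takes values in $[0,1]$, being a success probability with the reward normalized to $1$). A contract is a number $\alpha\in[0,1]$. The agent's utility is $u_a(\alpha,S)=\alpha f(S)-c(S)$. Let $D_{f,c}(\alpha)=\operatorname{argmax}_{S\subseteq A}u_a(\alpha,S)$ and $D^*_{f,c}(\alpha)=\operatorname{argmax}_{S\in D_{f,c}(\alpha)}f(S)$. Any $S_\alpha\in D^*_{f,c}(\alpha)$ is an agent's best response; $f(S_\alpha)$ does not depend on the choice. The principal's utility is $u_p(\alpha)=(1-\alpha)f(S_\alpha)$; the optimal contract problem is to find $\alpha\in[0,1]$ maximizing $u_p(\alpha)$. $c$ is additive if $c(S)=\sum_{a\in S}c(\{a\})$ (given by its $n$ values). A value query returns $f(S)$ for a given $S\subseteq A$. Polynomial time means that the number of value queries and elementary arithmetic operations/comparisons on reals is bounded by a polynomial in $n$. Ultra: $f$ is Ultra if it satisfies the exchange property: for all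 $S,T\subseteq A$ with $|S|\le|T|$ and every $x\in S\setminus T$ there is $y\in T\setminus S$ with $f(S)+f(T)\le f((S\setminus\{x\})\cup\{y\})+f((T\setminus\{y\})\cup\{x\})$. It is known that this is equivalent to the well-layered property: for every price vector $p\in\mathbb{R}^n_{\ge0}$ and every sequence $S_0=\emptyset$, $S_i=S_{i-1}\cup\{x_i\}$ with $x_i\in\operatorname{argmax}_{x\notin S_{i-1}}\{f(S_{i-1}\cup\{x\})-f(S_{i-1})-p_x\}$ (ties broken arbitrarily), one has $S_i\in\operatorname{argmax}_{|S|=i}\{f(S)-\sum_{x\in S}p_x\}$ for every $i\in[n]$. *)

theory Defs
  imports Complex_Main "HOL-Computational_Algebra.Polynomial"
begin

section \<open>Combinatorial contracts\<close>

definition nonneg_set_function :: "'a set \<Rightarrow> ('a set \<Rightarrow> real) \<Rightarrow> bool" where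
  "nonneg_set_function A g \<longleftrightarrow> (\<forall>S\<subseteq>A. 0 \<le> g S)"

definition additive_set_function :: "'a set \<Rightarrow> ('a set \<Rightarrow> real) \<Rightarrow> bool" where
  "additive_set_function A c \<longleftrightarrow> (\<forall>S\<subseteq>A. c S = (\<Sum>a\<in>S. c {a}))"

definition ultra :: "'a set \<Rightarrow> ('a set \<Rightarrow> real) \<Rightarrow> bool" where
  "ultra A f \<longleftrightarrow>
     (\<forall>S T. S \<subseteq> A \<and> T \<subseteq> A \<and> card S \<le> card T \<longrightarrow>
        (\<forall>x\<in>S - T. \<exists>y\<in>T - S.
           f S + f T \<le> f ((S - {x}) \<union> {y}) + f ((T - {y}) \<union> {x})))"

definition agent_utility :: "('a set \<Rightarrow> real) \<Rightarrow> ('a set \<Rightarrow> real) \<Rightarrow> real \<Rightarrow> 'a set \<Rightarrow> real" where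
  "agent_utility f c \<alpha> S = \<alpha> * f S - c S"

definition demand :: "'a set \<Rightarrow> ('a set \<Rightarrow> real) \<Rightarrow> ('a set \<Rightarrow> real) \<Rightarrow> real \<Rightarrow> 'a set set" where
  "demand A f c \<alpha> = {S. is_arg_max (agent_utility f c \<alpha>) (\<lambda>S. S \<subseteq> A) S}"

definition best_responses :: "'a set \<Rightarrow> ('a set \<Rightarrow> real) \<Rightarrow> ('a set \<Rightarrow> real) \<Rightarrow> real \<Rightarrow> 'a set set" where
  "best_responses A f c \<alpha> = {S. is_arg_max f (\<lambda>S. S \<in> demand A f c \<alpha>) S}"

text \<open>
  All best responses have the same reward, so the choice made here is immaterial; for finite
  \<open>A\<close> a best response always exists.
\<close>

definition principal_utility :: "'a set \<Rightarrow> ('a set \<Rightarrow> real) \<Rightarrow> ('a set \<Rightarrow> real) \<Rightarrow> real \<Rightarrow> real" where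
  "principal_utility A f c \<alpha> = (1 - \<alpha>) * f (SOME S. S \<in> best_responses A f c \<alpha>)"

definition optimal_contract :: "'a set \<Rightarrow> ('a set \<Rightarrow> real) \<Rightarrow> ('a set \<Rightarrow> real) \<Rightarrow> real \<Rightarrow> bool" where
  "optimal_contract A f c \<alpha> \<longleftrightarrow> is_arg_max (principal_utility A f c) (\<lambda>\<alpha>. \<alpha> \<in> {0..1}) \<alpha>"

section \<open>Algorithms with value queries\<close>

text \<open>
  Algorithms are programs of a real-number random access machine with a value oracle. A store
  consists of named arrays of natural numbers (counters, indices, bit vectors) and named arrays
  of reals; a scalar is an array used at index 0 only. The instruction set is restricted so that
  unit costs are honest. Natural numbers can be added and subtracted but not multiplied, hence
  their bit length grows by at most a constant per step. The only real constants are 0 and 1,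
  and reals influence natural numbers and control flow only through comparisons (there is no
  rounding). Real division by 0 yields 0, which a program could also achieve by a test.
\<close>

type_synonym vname = string

record store =
  nats :: "vname \<Rightarrow> nat \<Rightarrow> nat"
  reals :: "vname \<Rightarrow> nat \<Rightarrow> real"

datatype nexp = NConst nat | NGet vname nexp | NAdd nexp nexp | NSub nexp nexp

datatype rexp = RZero | ROne | RGet vname nexp
  | RAdd rexp rexp | RSub rexp rexp | RMul rexp rexp | RDiv rexp rexp

datatype bexp = NLess nexp nexp | RLess rexp rexp | BNot bexp | BAnd bexp bexp

datatype com =
    Skip
  | NSet vname nexp nexp
  | RSet vname nexp rexp
  | Query vname nexp vname
  | Seq com com
  | Cond bexp com com
  | While bexp com

primrec nval :: "nexp \<Rightarrow> store \<Rightarrow> nat" where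
  "nval (NConst k) s = k"
| "nval (NGet x i) s = nats s x (nval i s)"
| "nval (NAdd a b) s = nval a s + nval b s"
| "nval (NSub a b) s = nval a s - nval b s"

primrec rval :: "rexp \<Rightarrow> store \<Rightarrow> real" where
  "rval RZero s = 0"
| "rval ROne s = 1"
| "rval (RGet x i) s = reals s x (nval i s)"
| "rval (RAdd a b) s = rval a s + rval b s"
| "rval (RSub a b) s = rval a s - rval b s"
| "rval (RMul a b) s = rval a s * rval b s"
| "rval (RDiv a b) s = rval a s / rval b s"

primrec bval :: "bexp \<Rightarrow> store \<Rightarrow> bool" where
  "bval (NLess a b) s \<longleftrightarrow> nval a s < nval b s"
| "bval (RLess a b) s \<longleftrightarrow> rval a s < rval b s"
| "bval (BNot b) s \<longleftrightarrow> \<not> bval b s"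
| "bval (BAnd a b) s \<longleftrightarrow> bval a s \<and> bval b s"

text \<open>Every constant, memory access, operation and comparison costs one step.\<close>

primrec ncost :: "nexp \<Rightarrow> nat" where
  "ncost (NConst k) = 1"
| "ncost (NGet x i) = 1 + ncost i"
| "ncost (NAdd a b) = 1 + ncost a + ncost b"
| "ncost (NSub a b) = 1 + ncost a + ncost b"

primrec rcost :: "rexp \<Rightarrow> nat" where
  "rcost RZero = 1"
| "rcost ROne = 1"
| "rcost (RGet x i) = 1 + ncost i"
| "rcost (RAdd a b) = 1 + rcost a + rcost b"
| "rcost (RSub a b) = 1 + rcost a + rcost b"
| "rcost (RMul a b) = 1 + rcost a + rcost b"
| "rcost (RDiv a b) = 1 + rcost a + rcost b"

primrec bcost :: "bexp \<Rightarrow> nat" where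
  "bcost (NLess a b) = 1 + ncost a + ncost b"
| "bcost (RLess a b) = 1 + rcost a + rcost b"
| "bcost (BNot b) = 1 + bcost b"
| "bcost (BAnd a b) = 1 + bcost a + bcost b"

definition nupd :: "vname \<Rightarrow> nat \<Rightarrow> nat \<Rightarrow> store \<Rightarrow> store" where
  "nupd x i v s = s\<lparr>nats := (nats s)(x := (nats s x)(i := v))\<rparr>"

definition rupd :: "vname \<Rightarrow> nat \<Rightarrow> real \<Rightarrow> store \<Rightarrow> store" where
  "rupd x i v s = s\<lparr>reals := (reals s)(x := (reals s x)(i := v))\<rparr>"

text \<open>
  \<open>exec n f p s t s'\<close>: on actions \<open>{..<n}\<close> with value oracle \<open>f\<close>, program \<open>p\<close> started in
  store \<open>s\<close> terminates after \<open>t\<close> steps in store \<open>s'\<close>. The command \<open>Query x i y\<close> asks for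
  \<open>f\<close> at the set whose characteristic vector is held in the first \<open>n\<close> cells of the array
  \<open>y\<close>. This is the only access to \<open>f\<close>.
\<close>

inductive exec :: "nat \<Rightarrow> (nat set \<Rightarrow> real) \<Rightarrow> com \<Rightarrow> store \<Rightarrow> nat \<Rightarrow> store \<Rightarrow> bool"
  for n :: nat and f :: "nat set \<Rightarrow> real" where
  Skip: "exec n f Skip s 1 s"
| NSet: "exec n f (NSet x i e) s (1 + ncost i + ncost e) (nupd x (nval i s) (nval e s) s)"
| RSet: "exec n f (RSet x i e) s (1 + ncost i + rcost e) (rupd x (nval i s) (rval e s) s)"
| Query: "exec n f (Query x i y) s (1 + ncost i)
            (rupd x (nval i s) (f {j. j < n \<and> nats s y j \<noteq> 0}) s)"
| Seq: "exec n f p s t s' \<Longrightarrow> exec n f q s' t' s'' \<Longrightarrow> exec n f (Seq p q) s (t + t') s''"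
| CondTrue: "bval b s \<Longrightarrow> exec n f p s t s' \<Longrightarrow> exec n f (Cond b p q) s (bcost b + t) s'"
| CondFalse: "\<not> bval b s \<Longrightarrow> exec n f q s t s' \<Longrightarrow> exec n f (Cond b p q) s (bcost b + t) s'"
| WhileFalse: "\<not> bval b s \<Longrightarrow> exec n f (While b p) s (bcost b) s"
| WhileTrue: "bval b s \<Longrightarrow> exec n f p s t s' \<Longrightarrow> exec n f (While b p) s' t' s'' \<Longrightarrow>
    exec n f (While b p) s (bcost b + t + t') s''"

inductive_cases exec_SkipE: "exec n f Skip s t s'"
inductive_cases exec_NSetE: "exec n f (NSet x i e) s t s'"
inductive_cases exec_RSetE: "exec n f (RSet x i e) s t s'"
inductive_cases exec_QueryE: "exec n f (Query x i y) s t s'"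
inductive_cases exec_SeqE: "exec n f (Seq p q) s t s'"
inductive_cases exec_CondE: "exec n f (Cond b p q) s t s'"
inductive_cases exec_WhileE: "exec n f (While b p) s t s'"

text \<open>Runs are unique, so exhibiting one terminating run describes the behaviour of a program.\<close>

lemma exec_deterministic:
  assumes "exec n f p s t s'" and "exec n f p s u s''"
  shows "u = t \<and> s'' = s'"
  using assms
proof (induction arbitrary: u s'' rule: exec.induct)
  case (Skip s)
  then show ?case by (auto elim: exec_SkipE)
next
  case (NSet x i e s)
  then show ?case by (auto elim: exec_NSetE)
next
  case (RSet x i e s)
  then show ?case by (auto elim: exec_RSetE)
next
  case (Query x i y s)
  then show ?case by (auto elim: exec_QueryE)
next
  case (Seq p s t s' q t' s2)
  from Seq.prems obtain v w r where "exec n f p s v r" "exec n f q r w s''" "u = v + w"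
    by (auto elim: exec_SeqE)
  then show ?case using Seq.IH by metis
next
  case (CondTrue b s p t s' q)
  from CondTrue.prems CondTrue.hyps(1) obtain v where "exec n f p s v s''" "u = bcost b + v"
    by (auto elim: exec_CondE)
  then show ?case using CondTrue.IH by metis
next
  case (CondFalse b s q t s' p)
  from CondFalse.prems CondFalse.hyps(1) obtain v where "exec n f q s v s''" "u = bcost b + v"
    by (auto elim: exec_CondE)
  then show ?case using CondFalse.IH by metis
next
  case (WhileFalse b s p)
  from WhileFalse.prems WhileFalse.hyps show ?case by (auto elim: exec_WhileE)
next
  case (WhileTrue b s p t s' t' s2)
  from WhileTrue.prems WhileTrue.hyps(1) obtain v w r
    where "exec n f p s v r" "exec n f (While b p) r w s''" "u = bcost b + v + w"
    by (auto elim: exec_WhileE)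
  then show ?case using WhileTrue.IH by metis
qed

text \<open>
  The input consists of \<open>n\<close> and the \<open>n\<close> costs of the single actions; all other cells are 0.
\<close>

definition input_store :: "nat \<Rightarrow> (nat set \<Rightarrow> real) \<Rightarrow> store" where
  "input_store n c =
     \<lparr>nats = (\<lambda>x i. if x = ''n'' \<and> i = 0 then n else 0),
      reals = (\<lambda>x i. if x = ''c'' \<and> i < n then c {i} else 0)\<rparr>"

definition output_value :: "store \<Rightarrow> real" where
  "output_value s = reals s ''alpha'' 0"

end

theory Submission
  imports Defs
begin

text \<open>
  The function \<open>\<alpha> \<mapsto> max\<^sub>S (\<alpha> f(S) - c(S))\<close> is an upper envelope of lines, and the principal's optimum
  is attained at \<open>0\<close> or at one of its breakpoints. By the exchange property, the greedy sets are
  optimal in their layers (sets of equal cardinality), so the best of them attains the envelope at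
  a given \<open>\<alpha>\<close>. All breakpoints are found by repeatedly crossing two known lines and evaluating the
  envelope at the crossing. This takes polynomially many evaluations: let the rank of a set be the
  sum over its actions of the number of cheaper actions. Exchanges show that, within a layer, a
  larger reward at a larger contract forces a larger rank. Ranks are at most \<open>n\<^sup>2\<close>, so each layer
  contributes at most \<open>n\<^sup>2 + 1\<close> slopes.
\<close>

section \<open>Layers of an Ultra function\<close>

text \<open>On a stretch of contracts with constant reward the factor 1 - \<alpha> falls, so only
  the left ends of such stretches compete. Within a layer, exchanges connect two tied optimal sets
  through optimal sets only. If one end has extreme cost, every exchange compares the costs of its
  two actions in the same direction, so the rank follows the cost. If the crossing of two lines is
  covered by a third set of the layer, the comparison is split at that set. Swaps preserve
  cardinality, which is why layers are counted separately. The search may use an arbitrary optimal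
  set at each evaluation. Ties broken towards small rewards do no harm: the right-hand line of a
  breakpoint is itself optimal there, so a best response yields at least its reward.\<close>

locale ultra_contract =
  fixes A :: "'a set" and f c :: "'a set \<Rightarrow> real"
  assumes finite_A [simp]: "finite A"
    and ultra_f: "ultra A f"
    and additive_c: "additive_set_function A c"
begin

abbreviation utility :: "real \<Rightarrow> 'a set \<Rightarrow> real" where
  "utility \<equiv> agent_utility f c"

definition layer_demand :: "real \<Rightarrow> nat \<Rightarrow> 'a set set" where
  "layer_demand \<alpha> k =
     {S. S \<subseteq> A \<and> card S = k \<and> (\<forall>T. T \<subseteq> A \<and> card T = k \<longrightarrow> utility \<alpha> T \<le> utility \<alpha> S)}"

lemma layer_demandI:
  assumes "S \<subseteq> A" "card S = k" "\<And>T. T \<subseteq> A \<Longrightarrow> card T = k \<Longrightarrow> utility \<alpha> T \<le> utility \<alpha> S"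
  shows "S \<in> layer_demand \<alpha> k"
  using assms by (auto simp: layer_demand_def)

lemma layer_demandD:
  assumes "S \<in> layer_demand \<alpha> k"
  shows "S \<subseteq> A" "finite S" "card S = k"
    "T \<subseteq> A \<Longrightarrow> card T = k \<Longrightarrow> utility \<alpha> T \<le> utility \<alpha> S"
proof -
  show S: "S \<subseteq> A" using assms by (simp add: layer_demand_def)
  show "finite S" by (rule finite_subset[OF S finite_A])
  show "card S = k" using assms unfolding layer_demand_def by blast
  show "T \<subseteq> A \<Longrightarrow> card T = k \<Longrightarrow> utility \<alpha> T \<le> utility \<alpha> S"
    using assms unfolding layer_demand_def by blast
qed

lemma layer_demand_mono:
  assumes "S \<in> layer_demand \<alpha> k" "T \<subseteq> A" "card T = k" "utility \<alpha> S \<le> utility \<alpha> T"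
  shows "T \<in> layer_demand \<alpha> k"
proof (rule layer_demandI[OF assms(2,3)])
  fix U assume "U \<subseteq> A" "card U = k"
  then have "utility \<alpha> U \<le> utility \<alpha> S" by (rule layer_demandD(4)[OF assms(1)])
  then show "utility \<alpha> U \<le> utility \<alpha> T" using assms(4) by (rule order_trans)
qed

lemma demand_iff:
  "S \<in> demand A f c \<alpha> \<longleftrightarrow> S \<subseteq> A \<and> (\<forall>T\<subseteq>A. utility \<alpha> T \<le> utility \<alpha> S)"
  by (auto simp: demand_def is_arg_max_def not_less)

lemma demand_layer: "S \<in> demand A f c \<alpha> \<Longrightarrow> S \<in> layer_demand \<alpha> (card S)"
  by (auto simp: demand_iff layer_demand_def)

section \<open>Costs, cardinalities and utilities under exchanges\<close>

lemma cost_empty [simp]: "c {} = 0"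
  using additive_c by (auto simp: additive_set_function_def)

lemma cost_insert:
  assumes "S \<subseteq> A" "x \<in> A" "x \<notin> S"
  shows "c (insert x S) = c S + c {x}"
proof -
  have "c (insert x S) = (\<Sum>a\<in>insert x S. c {a})" "c S = (\<Sum>a\<in>S. c {a})"
    using additive_c assms unfolding additive_set_function_def by blast+
  moreover have "finite S" using assms(1) finite_A by (rule finite_subset)
  ultimately show ?thesis using assms by simp
qed

lemma cost_swap:
  assumes "S \<subseteq> A" "x \<in> S" "y \<in> A" "y \<notin> S"
  shows "c (S - {x} \<union> {y}) = c S - c {x} + c {y}"
proof -
  have "S - {x} \<subseteq> A" "x \<in> A" "insert x (S - {x}) = S" using assms by auto
  then show ?thesis
    using cost_insert[of "S - {x}" x] cost_insert[of "S - {x}" y] assms by simp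
qed

lemma card_swap:
  assumes "finite S" "x \<in> S" "y \<notin> S"
  shows "card (S - {x} \<union> {y}) = card S"
  using assms card.remove[of S x] by simp

text \<open>Additive costs drop out, because what one set loses in the swap the other gains. So the
  exchange property passes from \<open>f\<close> to every utility with \<alpha> \<ge> 0.\<close>

lemma utility_exchange:
  assumes "S \<subseteq> A" "T \<subseteq> A" "card S \<le> card T" "x \<in> S - T" "0 \<le> \<alpha>"
  obtains y where "y \<in> T - S"
    "utility \<alpha> S + utility \<alpha> T \<le> utility \<alpha> (S - {x} \<union> {y}) + utility \<alpha> (T - {y} \<union> {x})"
proof -
  obtain y where y: "y \<in> T - S" "f S + f T \<le> f (S - {x} \<union> {y}) + f (T - {y} \<union> {x})"
    using ultra_f[unfolded ultra_def, rule_format, of S T x] assms by blast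
  moreover have "c (S - {x} \<union> {y}) = c S - c {x} + c {y}" "c (T - {y} \<union> {x}) = c T - c {y} + c {x}"
    using y assms cost_swap[of S x y] cost_swap[of T y x] by blast+
  moreover have "\<alpha> * (f S + f T) \<le> \<alpha> * (f (S - {x} \<union> {y}) + f (T - {y} \<union> {x}))"
    using y assms by (intro mult_left_mono) auto
  ultimately show thesis by (intro that[of y]) (auto simp: agent_utility_def algebra_simps)
qed

text \<open>Neither swapped set can beat the optimal set it came from, yet together they are at
  least as good, so both are optimal again.\<close>

lemma layer_exchange:
  assumes S: "S \<in> layer_demand \<alpha> k" and T: "T \<in> layer_demand \<alpha> k" and x: "x \<in> S - T" and "0 \<le> \<alpha>"
  obtains y where "y \<in> T - S" "S - {x} \<union> {y} \<in> layer_demand \<alpha> k" "T - {y} \<union> {x} \<in> layer_demand \<alpha> k"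
proof -
  note S' = layer_demandD[OF S] and T' = layer_demandD[OF T]
  obtain y where y: "y \<in> T - S"
    "utility \<alpha> S + utility \<alpha> T \<le> utility \<alpha> (S - {x} \<union> {y}) + utility \<alpha> (T - {y} \<union> {x})"
    using utility_exchange[of S T x \<alpha>] S' T' assms by auto
  have sub: "S - {x} \<union> {y} \<subseteq> A" "T - {y} \<union> {x} \<subseteq> A" using S'(1) T'(1) x y by auto
  have crd: "card (S - {x} \<union> {y}) = k" "card (T - {y} \<union> {x}) = k"
    using card_swap[of S x y] card_swap[of T y x] x y S' T' by auto
  have le: "utility \<alpha> (S - {x} \<union> {y}) \<le> utility \<alpha> S" "utility \<alpha> (T - {y} \<union> {x}) \<le> utility \<alpha> T"
    using S'(4) T'(4) sub crd by auto
  show thesis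
  proof (rule that[OF y(1)])
    show "S - {x} \<union> {y} \<in> layer_demand \<alpha> k"
      using y(2) le sub crd by (intro layer_demand_mono[OF S]) auto
    show "T - {y} \<union> {x} \<in> layer_demand \<alpha> k"
      using y(2) le sub crd by (intro layer_demand_mono[OF T]) auto
  qed
qed

lemma layer_demand_exists:
  assumes "S \<subseteq> A"
  obtains U where "U \<in> layer_demand \<alpha> (card S)"
proof -
  let ?F = "{T. T \<subseteq> A \<and> card T = card S}"
  have "finite ?F" "?F \<noteq> {}" using assms by auto
  then obtain U where "is_arg_min (\<lambda>T. - utility \<alpha> T) (\<lambda>T. T \<in> ?F) U"
    using ex_is_arg_min_if_finite by blast
  then have "U \<in> ?F" "\<forall>T\<in>?F. utility \<alpha> T \<le> utility \<alpha> U"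
    by (auto simp: is_arg_min_def not_less)
  then have "U \<in> layer_demand \<alpha> (card S)" by (auto simp: layer_demand_def)
  then show thesis by (rule that)
qed

text \<open>An optimal set of the next layer can be exchanged towards \<open>X\<close> until it contains \<open>X\<close>.\<close>

lemma greedy_step:
  assumes X: "X \<in> layer_demand \<alpha> k" and x: "x \<in> A - X" and "0 \<le> \<alpha>"
    and best: "\<And>y. y \<in> A - X \<Longrightarrow> utility \<alpha> (insert y X) \<le> utility \<alpha> (insert x X)"
  shows "insert x X \<in> layer_demand \<alpha> (Suc k)"
proof -
  note X' = layer_demandD[OF X]
  have crd: "card (insert x X) = Suc k" using X' x by simp
  have sub: "insert x X \<subseteq> A" using X' x by simp
  have "\<exists>T\<in>layer_demand \<alpha> (Suc k). X \<subseteq> T"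
    if "U \<in> layer_demand \<alpha> (Suc k)" for U
    using that
  proof (induction "card (X - U)" arbitrary: U rule: less_induct)
    case less
    note U' = layer_demandD[OF less.prems]
    show ?case
    proof (cases "X \<subseteq> U")
      case True then show ?thesis using less.prems by auto
    next
      case False
      then obtain z where z: "z \<in> X - U" by auto
      obtain y where y: "y \<in> U - X"
        "utility \<alpha> X + utility \<alpha> U \<le> utility \<alpha> (X - {z} \<union> {y}) + utility \<alpha> (U - {y} \<union> {z})"
        using utility_exchange[of X U z \<alpha>] X' U' z \<open>0 \<le> \<alpha>\<close> by auto
      have "X - {z} \<union> {y} \<subseteq> A" "card (X - {z} \<union> {y}) = k"
        using card_swap[of X z y] X' U'(1) y z by auto
      \<comment> \<open>The swapped version of \<open>X\<close> cannot gain, since \<open>X\<close>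
        is optimal in its layer. Hence the swapped version of \<open>U\<close> does not lose, and it
        contains one more element of \<open>X\<close>.\<close>
      then have "utility \<alpha> (X - {z} \<union> {y}) \<le> utility \<alpha> X" by (rule X'(4))
      then have le: "utility \<alpha> U \<le> utility \<alpha> (U - {y} \<union> {z})" using y by simp
      have "U - {y} \<union> {z} \<subseteq> A" "card (U - {y} \<union> {z}) = Suc k"
        using card_swap[of U y z] X'(1) U' y z by auto
      then have "U - {y} \<union> {z} \<in> layer_demand \<alpha> (Suc k)"
        using le by (intro layer_demand_mono[OF less.prems]) auto
      moreover have "X - (U - {y} \<union> {z}) \<subset> X - U" using y z by auto
      then have "card (X - (U - {y} \<union> {z})) < card (X - U)"
        using X' by (intro psubset_card_mono) auto
      ultimately show ?thesis using less.hyps by blast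
    qed
  qed
  then obtain T where T: "T \<in> layer_demand \<alpha> (Suc k)" "X \<subseteq> T"
    using layer_demand_exists[OF sub, of \<alpha>] crd by metis
  note T' = layer_demandD[OF T(1)]
  have "card (T - X) = 1" using T T' X' by (simp add: card_Diff_subset)
  then obtain y where "T - X = {y}" by (auto simp: card_1_singleton_iff)
  then have "T = insert y X" "y \<in> A - X" using T T' by auto
  then have "utility \<alpha> T \<le> utility \<alpha> (insert x X)" using best by auto
  then show ?thesis using sub crd by (intro layer_demand_mono[OF T(1)]) auto
qed

section \<open>The number of slopes\<close>

text \<open>An integer substitute for the cost. The comparison is strict, so actions of equal cost
  weigh the same and a swap raises the rank exactly when it brings in a costlier action.\<close>

definition cost_rank :: "'a set \<Rightarrow> nat" where
  "cost_rank S = (\<Sum>a\<in>S. card {b\<in>A. c {b} < c {a}})"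

lemma cost_rank_le: "S \<subseteq> A \<Longrightarrow> cost_rank S \<le> card A * card A"
proof -
  assume "S \<subseteq> A"
  have "cost_rank S \<le> of_nat (card S) * card A"
    unfolding cost_rank_def by (rule sum_bounded_above) (auto intro: card_mono)
  also have "\<dots> \<le> card A * card A" using \<open>S \<subseteq> A\<close> by (simp add: card_mono)
  finally show ?thesis .
qed

lemma cost_rank_swap:
  assumes "S \<subseteq> A" "x \<in> S" "y \<in> A" "y \<notin> S" "c {x} \<le> c {y}"
  shows "cost_rank S \<le> cost_rank (S - {x} \<union> {y})"
    and "c {x} < c {y} \<Longrightarrow> cost_rank S < cost_rank (S - {x} \<union> {y})"
proof -
  let ?r = "\<lambda>a. card {b\<in>A. c {b} < c {a}}"
  have fin: "finite S" using assms(1) finite_subset finite_A by blast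
  have eq: "cost_rank S = ?r x + cost_rank (S - {x})"
    "cost_rank (S - {x} \<union> {y}) = ?r y + cost_rank (S - {x})"
    using fin assms sum.remove[of S x ?r] by (simp_all add: cost_rank_def)
  have "?r x \<le> ?r y" using assms by (intro card_mono) auto
  then show "cost_rank S \<le> cost_rank (S - {x} \<union> {y})" using eq by simp
  assume "c {x} < c {y}"
  then have "{b\<in>A. c {b} < c {x}} \<subset> {b\<in>A. c {b} < c {y}}" using assms by (auto intro: order.strict_trans)
  then have "?r x < ?r y" by (intro psubset_card_mono) auto
  then show "cost_rank S < cost_rank (S - {x} \<union> {y})" using eq by simp
qed

text \<open>A swap at a cheapest \<open>S\<close> cannot lower its cost and a swap at a costliest
  \<open>T\<close> cannot raise it, so either alternative forces c {x} \<le> c {y} for the exchanged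
  pair. The induction moves the other set only, and thus keeps the extremal one.\<close>

lemma cost_rank_layer_less:
  assumes "S \<in> layer_demand \<alpha> k" "T \<in> layer_demand \<alpha> k" "0 \<le> \<alpha>"
    and "(\<forall>X\<in>layer_demand \<alpha> k. c S \<le> c X) \<or> (\<forall>X\<in>layer_demand \<alpha> k. c X \<le> c T)"
  shows "cost_rank S \<le> cost_rank T \<and> (c S < c T \<longrightarrow> cost_rank S < cost_rank T)"
  using assms
proof (induction "card (S - T)" arbitrary: S T rule: less_induct)
  case less
  note S = layer_demandD[OF less.prems(1)] and T = layer_demandD[OF less.prems(2)]
  show ?case
  proof (cases "S \<subseteq> T")
    case True
    then have "S = T" using S T by (metis card_subset_eq)
    then show ?thesis by simp
  next
    case False
    then obtain x where x: "x \<in> S - T" by auto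
    obtain y where y: "y \<in> T - S" and S': "S - {x} \<union> {y} \<in> layer_demand \<alpha> k"
      and T': "T - {y} \<union> {x} \<in> layer_demand \<alpha> k"
      using layer_exchange[OF less.prems(1,2) x less.prems(3)] .
    have cS: "c (S - {x} \<union> {y}) = c S - c {x} + c {y}" and cT: "c (T - {y} \<union> {x}) = c T - c {y} + c {x}"
      using x y S(1) T(1) cost_swap[of S x y] cost_swap[of T y x] by blast+
    have xA: "x \<in> A" "y \<in> A" using x y S(1) T(1) by auto
    have xy: "c {x} \<le> c {y}"
      using less.prems(4) S' T' cS cT by fastforce
    from less.prems(4) show ?thesis
    proof
      assume min: "\<forall>X\<in>layer_demand \<alpha> k. c S \<le> c X"
      have "S - (T - {y} \<union> {x}) \<subset> S - T" using x y by auto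
      then have "card (S - (T - {y} \<union> {x})) < card (S - T)" using S by (intro psubset_card_mono) auto
      then have IH: "cost_rank S \<le> cost_rank (T - {y} \<union> {x}) \<and>
          (c S < c (T - {y} \<union> {x}) \<longrightarrow> cost_rank S < cost_rank (T - {y} \<union> {x}))"
        using less.hyps less.prems T' min by blast
      have "T - {y} \<union> {x} - {x} \<union> {y} = T" using x y by auto
      then have "cost_rank (T - {y} \<union> {x}) \<le> cost_rank T"
        "c {x} < c {y} \<Longrightarrow> cost_rank (T - {y} \<union> {x}) < cost_rank T"
        using cost_rank_swap[of "T - {y} \<union> {x}" x y] xy xA x y layer_demandD(1)[OF T'] by auto
      \<comment> \<open>For equal costs of \<open>x\<close> and \<open>y\<close> strictness must
        come from the induction hypothesis, as the swapped set costs the same as \<open>T\<close>;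
        otherwise the swap itself is strict.\<close>
      then show ?thesis using IH cT xy by (cases "c {x} < c {y}") auto
    next
      assume max: "\<forall>X\<in>layer_demand \<alpha> k. c X \<le> c T"
      have "S - {x} \<union> {y} - T \<subset> S - T" using x y by auto
      then have "card (S - {x} \<union> {y} - T) < card (S - T)" using S by (intro psubset_card_mono) auto
      then have IH: "cost_rank (S - {x} \<union> {y}) \<le> cost_rank T \<and>
          (c (S - {x} \<union> {y}) < c T \<longrightarrow> cost_rank (S - {x} \<union> {y}) < cost_rank T)"
        using less.hyps less.prems S' max by blast
      have "cost_rank S \<le> cost_rank (S - {x} \<union> {y})"
        "c {x} < c {y} \<Longrightarrow> cost_rank S < cost_rank (S - {x} \<union> {y})"
        using cost_rank_swap[of S x y] xy xA x y S by auto
      then show ?thesis using IH cS xy by (cases "c {x} < c {y}") auto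
    qed
  qed
qed

text \<open>Adding the two inequalities cancels the costs and leaves (\<beta> - \<alpha>) * (f T - f
  S) \<ge> 0.\<close>

lemma reward_mono:
  assumes "utility \<alpha> T \<le> utility \<alpha> S" "utility \<beta> S \<le> utility \<beta> T" "\<alpha> < \<beta>"
  shows "f S \<le> f T"
proof -
  have "0 \<le> (\<beta> - \<alpha>) * (f T - f S)" using assms by (simp add: agent_utility_def algebra_simps)
  then show ?thesis using assms by (simp add: zero_le_mult_iff)
qed

text \<open>With one strict inequality the product of differences is positive, which also rules out
  \<alpha> = \<beta>.\<close>

lemma reward_strict_mono:
  assumes "utility \<alpha> T \<le> utility \<alpha> S" "utility \<beta> S < utility \<beta> T" "\<alpha> \<le> \<beta>"
  shows "\<alpha> < \<beta> \<and> f S < f T"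
proof -
  have "0 < (\<beta> - \<alpha>) * (f T - f S)" using assms by (simp add: agent_utility_def algebra_simps)
  then show ?thesis using assms by (auto simp: zero_less_mult_iff)
qed

lemma reward_strict_mono':
  assumes "utility \<alpha> T < utility \<alpha> S" "utility \<beta> S \<le> utility \<beta> T" "\<alpha> \<le> \<beta>"
  shows "\<alpha> < \<beta> \<and> f S < f T"
proof -
  have "0 < (\<beta> - \<alpha>) * (f T - f S)" using assms by (simp add: agent_utility_def algebra_simps)
  then show ?thesis using assms by (auto simp: zero_less_mult_iff)
qed

definition crossing :: "'a set \<Rightarrow> 'a set \<Rightarrow> real" where
  "crossing S T = (c T - c S) / (f T - f S)"

lemma utility_crossing:
  "f S < f T \<Longrightarrow> utility (crossing S T) S = utility (crossing S T) T"
  by (simp add: crossing_def agent_utility_def field_simps)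

lemma crossing_bounds:
  assumes "f S < f T"
  shows "utility \<alpha> T \<le> utility \<alpha> S \<Longrightarrow> \<alpha> \<le> crossing S T"
    and "utility \<alpha> S \<le> utility \<alpha> T \<Longrightarrow> crossing S T \<le> \<alpha>"
  using assms by (simp_all add: crossing_def agent_utility_def field_simps)

text \<open>
  At \<open>\<alpha> = 0\<close> the claim can fail: there, two optimal sets of equal cost may have different
  rewards.
\<close>

lemma cost_rank_strict_mono:
  assumes "S \<in> layer_demand \<alpha> k" "T \<in> layer_demand \<beta> k" "0 < \<alpha>" "\<alpha> < \<beta>" "f S < f T"
  shows "cost_rank S < cost_rank T"
  using assms
\<comment> \<open>Only finitely many rewards are attained, and splitting at a set with a reward
  strictly in between leaves fewer of them on either side.\<close>
proof (induction "card {r \<in> f ` Pow A. f S < r \<and> r < f T}" arbitrary: S T \<alpha> \<beta> rule: less_induct)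
  case less
  note S = layer_demandD[OF less.prems(1)] and T = layer_demandD[OF less.prems(2)]
  define \<gamma> where "\<gamma> = crossing S T"
  have eq: "utility \<gamma> S = utility \<gamma> T"
    unfolding \<gamma>_def using less.prems by (intro utility_crossing)
  have \<gamma>: "\<alpha> \<le> \<gamma>" "\<gamma> \<le> \<beta>"
    unfolding \<gamma>_def using crossing_bounds[OF less.prems(5)] S T by auto
  obtain U where U0: "U \<in> layer_demand \<gamma> k" using layer_demand_exists[OF S(1)] S(3) by metis
  note U = layer_demandD[OF U0]
  show ?case
  proof (cases "utility \<gamma> S < utility \<gamma> U")
    case False
    then have S\<gamma>: "S \<in> layer_demand \<gamma> k"
      using S(1,3) by (intro layer_demand_mono[OF U0]) auto
    then have T\<gamma>: "T \<in> layer_demand \<gamma> k"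
      using T(1,3) eq by (intro layer_demand_mono[OF S\<gamma>]) auto
    \<comment> \<open>Among sets tied at a positive contract, the order by reward is the order by
      cost.\<close>
    have cost_le: "c X \<le> c Y" if "X \<in> layer_demand \<gamma> k" "Y \<in> layer_demand \<gamma> k" "f X \<le> f Y" for X Y
    proof -
      have "utility \<gamma> X = utility \<gamma> Y"
        using that layer_demandD[OF that(1)] layer_demandD[OF that(2)] by (intro order_antisym) auto
      moreover have "\<gamma> * f X \<le> \<gamma> * f Y" using that \<gamma> less.prems by (intro mult_left_mono) auto
      ultimately show ?thesis by (simp add: agent_utility_def)
    qed
    have "\<gamma> * f S < \<gamma> * f T" using \<gamma> less.prems by simp
    then have "c S < c T" using eq by (simp add: agent_utility_def)
    \<comment> \<open>Since \<alpha> < \<beta>, the crossing lies strictly right of \<alpha> or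
      strictly left of \<beta>. In the first case \<open>S\<close> has least reward among the
      optimal sets of the layer at \<gamma>, in the second \<open>T\<close> has greatest
      reward.\<close>
    moreover have "(\<forall>X\<in>layer_demand \<gamma> k. c S \<le> c X) \<or> (\<forall>X\<in>layer_demand \<gamma> k. c X \<le> c T)"
    proof (cases "\<alpha> < \<gamma>")
      case True
      have "f S \<le> f X" if X: "X \<in> layer_demand \<gamma> k" for X
        by (rule reward_mono[OF S(4) layer_demandD(4)[OF X S(1,3)] True]) (rule layer_demandD[OF X])+
      then show ?thesis using cost_le S\<gamma> by blast
    next
      case False
      then have "\<gamma> < \<beta>" using \<gamma> less.prems by simp
      have "f X \<le> f T" if X: "X \<in> layer_demand \<gamma> k" for X
        by (rule reward_mono[OF layer_demandD(4)[OF X T(1,3)] T(4) \<open>\<gamma> < \<beta>\<close>]) (rule layer_demandD[OF X])+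
      then show ?thesis using cost_le T\<gamma> by blast
    qed
    ultimately show ?thesis using cost_rank_layer_less[OF S\<gamma> T\<gamma>] \<gamma> less.prems by auto
  next
    case True
    \<comment> \<open>A third set of the layer lies above the crossing. Its contract and its reward
      are strictly between those of \<open>S\<close> and \<open>T\<close>, so the claim can be
      composed from two smaller instances.\<close>
    have SU: "\<alpha> < \<gamma> \<and> f S < f U"
      by (rule reward_strict_mono[OF S(4)[OF U(1,3)] True \<gamma>(1)])
    have "utility \<gamma> T < utility \<gamma> U" using True eq by simp
    then have UT: "\<gamma> < \<beta> \<and> f U < f T"
      by (rule reward_strict_mono'[OF _ T(4)[OF U(1,3)] \<gamma>(2)])
    let ?N = "\<lambda>S T. {r \<in> f ` Pow A. f S < r \<and> r < f T}"
    have "?N S U \<subset> ?N S T" "?N U T \<subset> ?N S T" using SU UT U(1) by auto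
    then have card_less: "card (?N S U) < card (?N S T)" "card (?N U T) < card (?N S T)"
      by (auto intro!: psubset_card_mono)
    then have "cost_rank S < cost_rank U"
      using less.hyps[of S U \<alpha> \<gamma>] less.prems(1,3) U0 SU by simp
    moreover have "cost_rank U < cost_rank T"
      using card_less(2) less.hyps[of U T \<gamma> \<beta>] less.prems(2,3) U0 SU UT by simp
    ultimately show ?thesis by simp
  qed
qed

text \<open>The restriction at contract 0 avoids the ties in which rank and reward are unrelated:
  the empty set is alone in its layer.\<close>

definition slope_chain :: "(real \<times> 'a set) list \<Rightarrow> bool" where
  "slope_chain zs \<longleftrightarrow>
     sorted_wrt (\<lambda>p q. fst p < fst q \<and> f (snd p) < f (snd q)) zs \<and>
     (\<forall>(\<alpha>, S)\<in>set zs. S \<in> demand A f c \<alpha> \<and> 0 \<le> \<alpha> \<and> (\<alpha> = 0 \<longrightarrow> S = {}))"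

text \<open>Cardinality and rank together label the entries injectively. Both coordinates start from
  0, hence the two successors.\<close>

lemma slope_chain_length:
  assumes "slope_chain zs"
  shows "length zs \<le> Suc (card A) * Suc (card A * card A)"
proof -
  let ?g = "\<lambda>p :: real \<times> 'a set. (card (snd p), cost_rank (snd p))"
  have sorted: "sorted_wrt (\<lambda>p q. fst p < fst q \<and> f (snd p) < f (snd q)) zs"
    and el: "\<And>p. p \<in> set zs \<Longrightarrow> snd p \<in> demand A f c (fst p) \<and> 0 \<le> fst p \<and> (fst p = 0 \<longrightarrow> snd p = {})"
    using assms by (auto simp: slope_chain_def)
  have neq: "?g (zs ! i) \<noteq> ?g (zs ! j)" if "i < j" "j < length zs" for i j
  proof
    assume eq: "?g (zs ! i) = ?g (zs ! j)"
    define p q where "p = zs ! i" and "q = zs ! j"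
    have lt: "fst p < fst q" "f (snd p) < f (snd q)"
      using sorted that by (auto simp: sorted_wrt_iff_nth_less p_def q_def)
    have pq: "p \<in> set zs" "q \<in> set zs" using that by (auto simp: p_def q_def)
    have lay: "snd p \<in> layer_demand (fst p) (card (snd p))" "snd q \<in> layer_demand (fst q) (card (snd p))"
      using demand_layer[of "snd p" "fst p"] demand_layer[of "snd q" "fst q"] el pq eq
      by (auto simp: p_def q_def)
    show False
    proof (cases "fst p = 0")
      case True
      then have "snd p = {}" using el pq by auto
      then show False using lt(2) layer_demandD(2,3)[OF lay(2)] by auto
    next
      case False
      then have "0 < fst p" using el[OF pq(1)] by simp
      then have "cost_rank (snd p) < cost_rank (snd q)" by (rule cost_rank_strict_mono[OF lay _ lt])
      then show False using eq by (simp add: p_def q_def)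
    qed
  qed
  have "distinct (map ?g zs)"
  proof (unfold distinct_conv_nth, intro allI impI)
    fix i j assume "i < length (map ?g zs)" "j < length (map ?g zs)" "i \<noteq> j"
    then show "map ?g zs ! i \<noteq> map ?g zs ! j"
      using neq[of i j] neq[of j i] by (cases "i < j") auto
  qed
  then have "length zs = card (set (map ?g zs))" using distinct_card by fastforce
  also have "\<dots> \<le> card ({..card A} \<times> {..card A * card A})"
  proof (intro card_mono subsetI)
    fix r assume "r \<in> set (map ?g zs)"
    then obtain p where "p \<in> set zs" and r: "r = ?g p" by auto
    then have "snd p \<subseteq> A" using el by (simp add: demand_iff)
    then show "r \<in> {..card A} \<times> {..card A * card A}"
      unfolding r by (simp add: card_mono cost_rank_le)
  qed simp
  finally show ?thesis by (simp add: card_cartesian_product)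
qed

end

section \<open>Timed total correctness\<close>

primrec written_nats :: "com \<Rightarrow> vname set" where
  "written_nats Skip = {}"
| "written_nats (NSet x i e) = {x}"
| "written_nats (RSet x i e) = {}"
| "written_nats (Query x i y) = {}"
| "written_nats (Seq p q) = written_nats p \<union> written_nats q"
| "written_nats (Cond b p q) = written_nats p \<union> written_nats q"
| "written_nats (While b p) = written_nats p"

primrec written_reals :: "com \<Rightarrow> vname set" where
  "written_reals Skip = {}"
| "written_reals (NSet x i e) = {}"
| "written_reals (RSet x i e) = {x}"
| "written_reals (Query x i y) = {x}"
| "written_reals (Seq p q) = written_reals p \<union> written_reals q"
| "written_reals (Cond b p q) = written_reals p \<union> written_reals q"
| "written_reals (While b p) = written_reals p"

text \<open>Lets specifications and loop invariants omit the variables that a command never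
  writes.\<close>

definition frame :: "com \<Rightarrow> store \<Rightarrow> store \<Rightarrow> bool" where
  "frame p s s' \<longleftrightarrow> (\<forall>x. x \<notin> written_nats p \<longrightarrow> nats s' x = nats s x) \<and>
     (\<forall>x. x \<notin> written_reals p \<longrightarrow> reals s' x = reals s x)"

lemma frameD:
  assumes "frame p s s'"
  shows "x \<notin> written_nats p \<Longrightarrow> nats s' x = nats s x"
    and "x \<notin> written_reals p \<Longrightarrow> reals s' x = reals s x"
  using assms by (auto simp: frame_def)

lemma frame_refl: "frame p s s"
  by (simp add: frame_def)

lemma frame_trans: "frame p s s' \<Longrightarrow> frame p s' s'' \<Longrightarrow> frame p s s''"
  by (simp add: frame_def)

lemma exec_frame: "exec n f p s t s' \<Longrightarrow> frame p s s'"
  by (induction rule: exec.induct) (auto simp: frame_def nupd_def rupd_def)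

lemma nats_nupd [simp]: "nats (nupd x i v s) y = (if y = x then (nats s x)(i := v) else nats s y)"
  and reals_nupd [simp]: "reals (nupd x i v s) = reals s"
  and nats_rupd [simp]: "nats (rupd x i r s) = nats s"
  and reals_rupd [simp]: "reals (rupd x i r s) y = (if y = x then (reals s x)(i := r) else reals s y)"
  by (simp_all add: nupd_def rupd_def)

section \<open>Symbolic execution of loop-free commands\<close>

primrec loop_free :: "com \<Rightarrow> bool" where
  "loop_free Skip \<longleftrightarrow> True"
| "loop_free (NSet x i e) \<longleftrightarrow> True"
| "loop_free (RSet x i e) \<longleftrightarrow> True"
| "loop_free (Query x i y) \<longleftrightarrow> True"
| "loop_free (Seq p q) \<longleftrightarrow> loop_free p \<and> loop_free q"
| "loop_free (Cond b p q) \<longleftrightarrow> loop_free p \<and> loop_free q"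
| "loop_free (While b p) \<longleftrightarrow> False"

text \<open>The values of \<open>run\<close> and \<open>com_cost\<close> on loops are junk.\<close>

primrec run :: "nat \<Rightarrow> (nat set \<Rightarrow> real) \<Rightarrow> com \<Rightarrow> store \<Rightarrow> store" where
  "run n f Skip s = s"
| "run n f (NSet x i e) s = nupd x (nval i s) (nval e s) s"
| "run n f (RSet x i e) s = rupd x (nval i s) (rval e s) s"
| "run n f (Query x i y) s = rupd x (nval i s) (f {j. j < n \<and> nats s y j \<noteq> 0}) s"
| "run n f (Seq p q) s = run n f q (run n f p s)"
| "run n f (Cond b p q) s = (if bval b s then run n f p s else run n f q s)"
| "run n f (While b p) s = s"

primrec com_cost :: "com \<Rightarrow> nat" where
  "com_cost Skip = 1"
| "com_cost (NSet x i e) = 1 + ncost i + ncost e"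
| "com_cost (RSet x i e) = 1 + ncost i + rcost e"
| "com_cost (Query x i y) = 1 + ncost i"
| "com_cost (Seq p q) = com_cost p + com_cost q"
| "com_cost (Cond b p q) = bcost b + com_cost p + com_cost q"
| "com_cost (While b p) = 0"

lemma exec_run: "loop_free p \<Longrightarrow> \<exists>t. exec n f p s t (run n f p s) \<and> t \<le> com_cost p"
proof (induction p arbitrary: s)
  case (Seq p q)
  then obtain t t' where "exec n f p s t (run n f p s)" "t \<le> com_cost p"
    "exec n f q (run n f p s) t' (run n f q (run n f p s))" "t' \<le> com_cost q" by fastforce
  then show ?case by (intro exI[of _ "t + t'"]) (auto intro: exec.Seq)
next
  case (Cond b p q)
  then obtain t t' where t: "exec n f p s t (run n f p s)" "t \<le> com_cost p"
    "exec n f q s t' (run n f q s)" "t' \<le> com_cost q" by fastforce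
  show ?case
  proof (cases "bval b s")
    case True
    then show ?thesis using t by (intro exI[of _ "bcost b + t"]) (auto intro: exec.CondTrue)
  next
    case False
    then show ?thesis using t by (intro exI[of _ "bcost b + t'"]) (auto intro: exec.CondFalse)
  qed
next
  case (Query x i y)
  show ?case unfolding run.simps com_cost.simps by (blast intro: exec.Query order_refl)
qed (auto intro!: exec.intros)

section \<open>Total correctness within a time bound\<close>

definition wp :: "nat \<Rightarrow> (nat set \<Rightarrow> real) \<Rightarrow> com \<Rightarrow> nat \<Rightarrow> (store \<Rightarrow> bool) \<Rightarrow> store \<Rightarrow> bool" where
  "wp n f p T Q s \<longleftrightarrow> (\<exists>t s'. exec n f p s t s' \<and> t \<le> T \<and> Q s')"

lemma wp_frame:
  assumes "wp n f p T Q s" "\<And>s'. Q s' \<Longrightarrow> frame p s s' \<Longrightarrow> R s'"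
  shows "wp n f p T R s"
  using assms exec_frame unfolding wp_def by blast

lemma wp_run: "loop_free p \<Longrightarrow> Q (run n f p s) \<Longrightarrow> com_cost p \<le> T \<Longrightarrow> wp n f p T Q s"
  unfolding wp_def using exec_run[of p n f s] order_trans by blast

lemma wp_Seq:
  assumes "wp n f p T\<^sub>1 R s" "\<And>s'. R s' \<Longrightarrow> frame p s s' \<Longrightarrow> wp n f q T\<^sub>2 Q s'" "T\<^sub>1 + T\<^sub>2 \<le> T"
  shows "wp n f (Seq p q) T Q s"
proof -
  obtain t s' where p: "exec n f p s t s'" "t \<le> T\<^sub>1" "R s'" using assms(1) by (auto simp: wp_def)
  then obtain t' s'' where q: "exec n f q s' t' s''" "t' \<le> T\<^sub>2" "Q s''"
    using assms(2)[OF p(3) exec_frame[OF p(1)]] by (auto simp: wp_def)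
  have "t + t' \<le> T" using p q assms(3) by linarith
  then show ?thesis unfolding wp_def using exec.Seq[OF p(1) q(1)] q(3) by blast
qed

text \<open>The variant also bounds the number of remaining rounds, so its initial bound
  \<open>M\<close> gives the running time; the separate \<open>bcost b\<close> pays for the last,
  failing test.\<close>

lemma wp_While:
  assumes "I m s" "m \<le> M"
    and body: "\<And>m s'. I m s' \<Longrightarrow> frame p s s' \<Longrightarrow> bval b s' \<Longrightarrow> wp n f p T (\<lambda>s''. \<exists>m'<m. I m' s'') s'"
    and exit: "\<And>m s'. I m s' \<Longrightarrow> frame p s s' \<Longrightarrow> \<not> bval b s' \<Longrightarrow> Q s'"
    and T': "bcost b + M * (bcost b + T) \<le> T'"
  shows "wp n f (While b p) T' Q s"
proof -
  have "wp n f (While b p) (bcost b + m * (bcost b + T)) Q s'" if "I m s'" "frame p s s'" for m s'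
    using that
  proof (induction m arbitrary: s' rule: less_induct)
    case (less m)
    show ?case
    proof (cases "bval b s'")
      case False
      then show ?thesis unfolding wp_def
        using exec.WhileFalse exit[OF less.prems] trans_le_add1 by blast
    next
      case True
      then obtain t s'' m' where p: "exec n f p s' t s''" "t \<le> T" "m' < m" "I m' s''"
        using body[OF less.prems] by (auto simp: wp_def)
      have "frame p s s''" using exec_frame[OF p(1)] less.prems(2) frame_trans by blast
      then have "wp n f (While b p) (bcost b + m' * (bcost b + T)) Q s''"
        using less.IH p by blast
      then obtain t' s3 where q: "exec n f (While b p) s'' t' s3"
        "t' \<le> bcost b + m' * (bcost b + T)" "Q s3" by (auto simp: wp_def)
      have "Suc m' * (bcost b + T) \<le> m * (bcost b + T)" using p by (intro mult_le_mono1) simp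
      then have "bcost b + t + t' \<le> bcost b + m * (bcost b + T)" using p q by simp
      then show ?thesis unfolding wp_def using exec.WhileTrue[OF True p(1) q(1)] q(3) by blast
    qed
  qed
  then have "wp n f (While b p) (bcost b + m * (bcost b + T)) Q s"
    using assms(1) frame_refl by blast
  moreover have "bcost b + m * (bcost b + T) \<le> T'"
    using T' mult_le_mono1[OF \<open>m \<le> M\<close>, of "bcost b + T"] by linarith
  ultimately show ?thesis unfolding wp_def using order_trans by blast
qed

section \<open>Searching the envelope\<close>

locale nonneg_ultra_contract = ultra_contract +
  assumes nonneg_f: "nonneg_set_function A f" and f_empty: "f {} = 0"
    and nonneg_c: "nonneg_set_function A c"
begin

text \<open>The lines \<open>us\<close> have been passed already; they remain in the chain so that
  its length bounds the number of steps. The value \<open>r\<close> need only be a lower bound at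
  \<alpha>, as a demanded set may have less reward than a best response. Contract 1 is excluded in
  the last two clauses: the principal gets 0 there, and the line found at 1 may have less reward
  than a best response at 1.\<close>

definition search_state ::
  "(real \<times> 'a set) list \<Rightarrow> real \<times> 'a set \<Rightarrow> (real \<times> 'a set) list \<Rightarrow> real \<Rightarrow> real \<Rightarrow> bool" where
  "search_state us p stk r \<alpha> \<longleftrightarrow>
     slope_chain (us @ p # stk) \<and> (\<forall>q\<in>set (us @ p # stk). fst q \<le> 1) \<and>
     \<alpha> \<in> {0..1} \<and> (\<exists>S\<in>demand A f c \<alpha>. r \<le> (1 - \<alpha>) * f S) \<and>
     (\<forall>\<beta> S. 0 \<le> \<beta> \<and> \<beta> < 1 \<and> S \<in> demand A f c \<beta> \<and> f S \<le> f (snd p) \<longrightarrow> (1 - \<beta>) * f S \<le> r) \<and>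
     (\<forall>\<beta> S. \<beta> < 1 \<and> S \<in> demand A f c \<beta> \<longrightarrow> f S \<le> f (snd (last (p # stk))))"

lemma demandD: "S \<in> demand A f c \<alpha> \<Longrightarrow> S \<subseteq> A"
  "S \<in> demand A f c \<alpha> \<Longrightarrow> T \<subseteq> A \<Longrightarrow> utility \<alpha> T \<le> utility \<alpha> S"
  by (auto simp: demand_iff)

lemma demand_reward_mono:
  assumes "S \<in> demand A f c \<alpha>" "T \<in> demand A f c \<beta>" "\<alpha> < \<beta>"
  shows "f S \<le> f T"
  using assms by (intro reward_mono[of \<alpha> T S \<beta>]) (auto simp: demandD)

lemma empty_demand: "{} \<in> demand A f c 0"
  using nonneg_c by (auto simp: demand_iff agent_utility_def nonneg_set_function_def)

lemma search_init:
  assumes X: "X \<in> demand A f c 1"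
  shows "0 < f X \<Longrightarrow> search_state [] (0, {}) [(1, X)] 0 0"
    and "f X \<le> 0 \<Longrightarrow> search_state [] (0, {}) [] 0 0"
proof -
  \<comment> \<open>Any set demanded at contract 1 bounds the reward at all smaller contracts, so
    the search can use it as the rightmost line.\<close>
  have le: "f S \<le> f X" if "\<beta> < 1" "S \<in> demand A f c \<beta>" for \<beta> S
    using demand_reward_mono[OF that(2) X that(1)] .
  have r: "\<exists>S\<in>demand A f c 0. 0 \<le> (1 - 0) * f S"
    using empty_demand f_empty by (intro bexI[of _ "{}"]) auto
  have covered: "(1 - \<beta>) * f S \<le> 0" if "\<beta> < 1" "f S \<le> f {}" for \<beta> S
    using that f_empty by (simp add: mult_le_0_iff)
  show "search_state [] (0, {}) [(1, X)] 0 0" if "0 < f X"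
    using that le r covered X f_empty empty_demand by (auto simp: search_state_def slope_chain_def)
  show "search_state [] (0, {}) [] 0 0" if "f X \<le> 0"
    using that le r covered f_empty empty_demand
    by (auto simp: search_state_def slope_chain_def intro: order_trans)
qed

lemma search_stateD:
  assumes "search_state us p (q # stk) r \<alpha>"
  shows "snd p \<in> demand A f c (fst p)" "snd q \<in> demand A f c (fst q)"
    "f (snd p) < f (snd q)" "0 \<le> fst p" "fst q \<le> 1"
    "fst p \<le> crossing (snd p) (snd q)" "crossing (snd p) (snd q) \<le> fst q"
proof -
  show p: "snd p \<in> demand A f c (fst p)" and q: "snd q \<in> demand A f c (fst q)"
    and lt: "f (snd p) < f (snd q)" and "0 \<le> fst p" "fst q \<le> 1"
    using assms by (auto simp: search_state_def slope_chain_def sorted_wrt_append)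
  show "fst p \<le> crossing (snd p) (snd q)" "crossing (snd p) (snd q) \<le> fst q"
    by (rule crossing_bounds(1)[OF lt demandD(2)[OF p demandD(1)[OF q]]],
        rule crossing_bounds(2)[OF lt demandD(2)[OF q demandD(1)[OF p]]])
qed

text \<open>At the crossing both old lines have the same height, so \<open>Y\<close> is strictly
  above both and fits strictly between them in contract and reward. In particular \<gamma> > 0, so
  the condition on contract 0 is vacuous for the new entry.\<close>

lemma search_push:
  assumes st: "search_state us p (q # stk) r \<alpha>" and \<gamma>: "\<gamma> = crossing (snd p) (snd q)"
    and Y: "Y \<in> demand A f c \<gamma>" and above: "utility \<gamma> (snd p) < utility \<gamma> Y"
  shows "search_state us p ((\<gamma>, Y) # q # stk) r \<alpha>"
proof -
  note D = search_stateD[OF st, folded \<gamma>]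
  have py: "fst p < \<gamma> \<and> f (snd p) < f Y"
    using demandD(2)[OF D(1) demandD(1)[OF Y]] above D(6) by (rule reward_strict_mono)
  have "utility \<gamma> (snd q) < utility \<gamma> Y"
    using above utility_crossing[OF D(3), folded \<gamma>] by simp
  then have yq: "\<gamma> < fst q \<and> f Y < f (snd q)"
    using demandD(2)[OF D(2) demandD(1)[OF Y]] D(7) by (rule reward_strict_mono')
  have chain: "slope_chain (us @ p # q # stk)" using st by (simp add: search_state_def)
  have "slope_chain (us @ p # (\<gamma>, Y) # q # stk)"
    unfolding slope_chain_def
  proof (intro conjI ballI)
    show "sorted_wrt (\<lambda>p q. fst p < fst q \<and> f (snd p) < f (snd q)) (us @ p # (\<gamma>, Y) # q # stk)"
      using chain py yq unfolding slope_chain_def sorted_wrt_append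
      by (auto intro: order.strict_trans)
    fix z assume "z \<in> set (us @ p # (\<gamma>, Y) # q # stk)"
    then show "case z of (\<alpha>, S) \<Rightarrow> S \<in> demand A f c \<alpha> \<and> 0 \<le> \<alpha> \<and> (\<alpha> = 0 \<longrightarrow> S = {})"
      using chain py Y D(4) by (auto simp: slope_chain_def)
  qed
  then show ?thesis using st yq by (auto simp: search_state_def)
qed

text \<open>Nothing beats the two lines at their crossing, so both sets are demanded there. A reward
  above that of \<open>p\<close> occurs only at contracts from \<gamma> on, so for the newly covered
  rewards (1 - \<beta>) * f S is at most (1 - \<gamma>) times the reward of
  \<open>q\<close>.\<close>

lemma search_pop:
  assumes st: "search_state us p (q # stk) r \<alpha>" and \<gamma>: "\<gamma> = crossing (snd p) (snd q)"
    and Y: "Y \<in> demand A f c \<gamma>" and below: "utility \<gamma> Y \<le> utility \<gamma> (snd p)"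
    and r': "r' = (1 - \<gamma>) * f (snd q)"
  shows "search_state (us @ [p]) q stk (max r r') (if r < r' then \<gamma> else \<alpha>)"
proof -
  note D = search_stateD[OF st, folded \<gamma>]
  have p: "snd p \<in> demand A f c \<gamma>"
    unfolding demand_iff using demandD(1)[OF D(1)] demandD(2)[OF Y] below order_trans by blast
  then have q: "snd q \<in> demand A f c \<gamma>"
    using utility_crossing[OF D(3), folded \<gamma>] demandD(1)[OF D(2)] by (simp add: demand_iff)
  have \<gamma>01: "0 \<le> \<gamma>" "\<gamma> \<le> 1" using D by auto
  have "(1 - \<beta>) * f S \<le> max r r'"
    if S: "0 \<le> \<beta>" "\<beta> < 1" "S \<in> demand A f c \<beta>" "f S \<le> f (snd q)" for \<beta> S
  proof (cases "f S \<le> f (snd p)")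
    case True
    then have "(1 - \<beta>) * f S \<le> r" using st S by (simp add: search_state_def)
    then show ?thesis by simp
  next
    case False
    then have "\<gamma> \<le> \<beta>" using demand_reward_mono[OF S(3) p] by force
    moreover have "0 \<le> f S" using nonneg_f demandD(1)[OF S(3)] by (simp add: nonneg_set_function_def)
    ultimately have "(1 - \<beta>) * f S \<le> r'" using S \<gamma>01 unfolding r' by (intro mult_mono) auto
    then show ?thesis by simp
  qed
  then show ?thesis
    using st q \<gamma>01 by (auto simp: search_state_def r' max_def)
qed

section \<open>From demanded sets to the principal's utility\<close>

lemma best_response_exists:
  obtains S where "S \<in> best_responses A f c \<alpha>"
proof -
  have "\<exists>S. is_arg_min (\<lambda>S. - utility \<alpha> S) (\<lambda>S. S \<in> Pow A) S"
    by (rule ex_is_arg_min_if_finite) auto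
  then obtain S where "S \<in> demand A f c \<alpha>"
    by (auto simp: is_arg_min_def demand_iff not_less)
  moreover have "finite (demand A f c \<alpha>)"
    by (rule finite_subset[of _ "Pow A"]) (auto simp: demand_iff)
  ultimately have "\<exists>S. is_arg_min (\<lambda>S. - f S) (\<lambda>S. S \<in> demand A f c \<alpha>) S"
    using ex_is_arg_min_if_finite[of "demand A f c \<alpha>" "\<lambda>S. - f S"] by blast
  then obtain S where "is_arg_min (\<lambda>S. - f S) (\<lambda>S. S \<in> demand A f c \<alpha>) S" ..
  then have "S \<in> best_responses A f c \<alpha>"
    by (auto simp: best_responses_def is_arg_min_def is_arg_max_def)
  then show thesis by (rule that)
qed

lemma principal_utility_best:
  obtains S where "S \<in> demand A f c \<alpha>" "principal_utility A f c \<alpha> = (1 - \<alpha>) * f S"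
    "\<And>T. T \<in> demand A f c \<alpha> \<Longrightarrow> f T \<le> f S"
proof -
  define S where "S = (SOME S. S \<in> best_responses A f c \<alpha>)"
  obtain S\<^sub>0 where "S\<^sub>0 \<in> best_responses A f c \<alpha>" by (rule best_response_exists)
  then have "S \<in> best_responses A f c \<alpha>" unfolding S_def by (rule someI)
  then show thesis
    by (intro that[of S]) (auto simp: best_responses_def is_arg_max_def not_less principal_utility_def S_def)
qed

text \<open>With an empty stack the current line is the rightmost one, so \<open>r\<close> bounds
  the utility at every contract below 1; at 1 the principal gets 0.\<close>

lemma search_final:
  assumes st: "search_state us p [] r \<alpha>"
  shows "optimal_contract A f c \<alpha>"
proof -
  have \<alpha>: "\<alpha> \<in> {0..1}" using st by (simp add: search_state_def)
  obtain S where S: "S \<in> demand A f c \<alpha>" "r \<le> (1 - \<alpha>) * f S" using st by (auto simp: search_state_def)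
  have nonneg: "0 \<le> principal_utility A f c \<beta>" if "\<beta> \<le> 1" for \<beta>
  proof -
    obtain T where "T \<in> demand A f c \<beta>" "principal_utility A f c \<beta> = (1 - \<beta>) * f T"
      by (rule principal_utility_best)
    then show ?thesis using that nonneg_f demandD(1) by (simp add: nonneg_set_function_def)
  qed
  have r: "r \<le> principal_utility A f c \<alpha>"
  proof -
    obtain T where T: "principal_utility A f c \<alpha> = (1 - \<alpha>) * f T"
      "\<And>T'. T' \<in> demand A f c \<alpha> \<Longrightarrow> f T' \<le> f T"
      by (rule principal_utility_best) blast
    have "(1 - \<alpha>) * f S \<le> (1 - \<alpha>) * f T" using T(2)[OF S(1)] \<alpha> by (intro mult_left_mono) auto
    then show ?thesis using T(1) S(2) by simp
  qed
  have "principal_utility A f c \<beta> \<le> principal_utility A f c \<alpha>" if \<beta>: "\<beta> \<in> {0..1}" for \<beta>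
  proof (cases "\<beta> = 1")
    case True
    then have "principal_utility A f c \<beta> = 0" by (simp add: principal_utility_def)
    then show ?thesis using nonneg[of \<alpha>] \<alpha> by simp
  next
    case False
    obtain T where T: "T \<in> demand A f c \<beta>" "principal_utility A f c \<beta> = (1 - \<beta>) * f T"
      by (rule principal_utility_best)
    have "\<beta> < 1" using False \<beta> by simp
    then have "(1 - \<beta>) * f T \<le> r" using st T(1) \<beta> by (simp add: search_state_def)
    then show ?thesis using T(2) r by simp
  qed
  then show ?thesis using \<alpha> by (auto simp: optimal_contract_def is_arg_max_def not_less)
qed

end

section \<open>The program\<close>

abbreviation nvar :: "vname \<Rightarrow> nexp" where "nvar x \<equiv> NGet x (NConst 0)"
abbreviation rvar :: "vname \<Rightarrow> rexp" where "rvar x \<equiv> RGet x (NConst 0)"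
abbreviation nset :: "vname \<Rightarrow> nexp \<Rightarrow> com" where "nset x \<equiv> NSet x (NConst 0)"
abbreviation rset :: "vname \<Rightarrow> rexp \<Rightarrow> com" where "rset x \<equiv> RSet x (NConst 0)"
abbreviation incr :: "vname \<Rightarrow> com" where "incr x \<equiv> nset x (NAdd (nvar x) (NConst 1))"

text \<open>
  Variables: \<open>a\<close> the current contract, \<open>v\<close> the last query answer, \<open>w\<close> the reward of the current set
  extended by the best candidate \<open>b\<close> found so far (\<open>b = n\<close> if there is none yet), \<open>k\<close> the cost
  of the current set \<open>S\<close>, \<open>F\<close> and \<open>C\<close> reward and cost of the best set found so far.
\<close>

definition clear_body :: com where
  "clear_body = Seq (NSet ''S'' (nvar ''j'') (NConst 0)) (incr ''j'')"

text \<open>Utility of an extension up to the cost of the current set, which all candidates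
  share.\<close>

definition candidate_value :: "rexp \<Rightarrow> vname \<Rightarrow> rexp" where
  "candidate_value r x = RSub (RMul (rvar ''a'') r) (RGet ''c'' (nvar x))"

definition scan_body :: com where
  "scan_body =
     Seq (Cond (NLess (NConst 0) (NGet ''S'' (nvar ''j''))) Skip
       (Seq (NSet ''S'' (nvar ''j'') (NConst 1))
       (Seq (Query ''v'' (NConst 0) ''S'')
       (Seq (NSet ''S'' (nvar ''j'') (NConst 0))
         (Cond (BAnd (NLess (nvar ''b'') (nvar ''n''))
             (BNot (RLess (candidate_value (rvar ''w'') ''b'') (candidate_value (rvar ''v'') ''j''))))
           Skip
           (Seq (nset ''b'' (nvar ''j'')) (rset ''w'' (rvar ''v''))))))))
     (incr ''j'')"

definition extend :: com where
  "extend =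
     Seq (NSet ''S'' (nvar ''b'') (NConst 1))
     (Seq (rset ''k'' (RAdd (rvar ''k'') (RGet ''c'' (nvar ''b''))))
     (Seq (Cond (RLess (RSub (RMul (rvar ''a'') (rvar ''F'')) (rvar ''C''))
                       (RSub (RMul (rvar ''a'') (rvar ''w'')) (rvar ''k'')))
            (Seq (rset ''F'' (rvar ''w'')) (rset ''C'' (rvar ''k''))) Skip)
     (incr ''i'')))"

definition scan_init :: com where
  "scan_init = Seq (nset ''j'' (NConst 0)) (nset ''b'' (nvar ''n''))"

definition layer_body :: com where
  "layer_body = Seq scan_init (Seq (While (NLess (nvar ''j'') (nvar ''n'')) scan_body) extend)"

definition greedy_init :: com where
  "greedy_init = Seq (nset ''i'' (NConst 0))
     (Seq (rset ''k'' RZero) (Seq (rset ''F'' RZero) (rset ''C'' RZero)))"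

definition best_response :: com where
  "best_response =
     Seq (nset ''j'' (NConst 0))
     (Seq (While (NLess (nvar ''j'') (nvar ''n'')) clear_body)
     (Seq greedy_init (While (NLess (nvar ''i'') (nvar ''n'')) layer_body)))"

text \<open>
  The lines right of the current line \<open>(LF, LC)\<close> are kept on a stack \<open>(TF, TC)\<close> of height \<open>m\<close>,
  with slopes decreasing towards the bottom. If the crossing of the current line with the top of
  the stack lies below the envelope, a best response found there is pushed. Otherwise the crossing
  is a breakpoint, hence a candidate for the optimal contract, and the top becomes the current line.
\<close>

definition push :: com where
  "push = Seq (RSet ''TF'' (nvar ''m'') (rvar ''F'')) (Seq (RSet ''TC'' (nvar ''m'') (rvar ''C'')) (incr ''m''))"

definition pop :: com where
  "pop =
     Seq (nset ''m'' (NSub (nvar ''m'') (NConst 1)))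
     (Seq (rset ''LF'' (RGet ''TF'' (nvar ''m'')))
     (Seq (rset ''LC'' (RGet ''TC'' (nvar ''m'')))
       (Cond (RLess (rvar ''best'') (RMul (RSub ROne (rvar ''a'')) (rvar ''LF'')))
         (Seq (rset ''best'' (RMul (RSub ROne (rvar ''a'')) (rvar ''LF'')))
              (rset ''alpha'' (rvar ''a''))) Skip)))"

definition cross :: com where
  "cross = rset ''a''
     (RDiv (RSub (RGet ''TC'' (NSub (nvar ''m'') (NConst 1))) (rvar ''LC''))
           (RSub (RGet ''TF'' (NSub (nvar ''m'') (NConst 1))) (rvar ''LF'')))"

definition update :: com where
  "update = Cond (RLess (RSub (RMul (rvar ''a'') (rvar ''LF'')) (rvar ''LC''))
                        (RSub (RMul (rvar ''a'') (rvar ''F'')) (rvar ''C''))) push pop"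

definition contract_program :: com where
  "contract_program =
     Seq (rset ''a'' ROne)
     (Seq best_response
     (Seq (Cond (RLess RZero (rvar ''F'')) push Skip)
       (While (NLess (NConst 0) (nvar ''m'')) (Seq cross (Seq best_response update)))))"

section \<open>Correctness of the best response computation\<close>

text \<open>The 5 is the cost of a loop test comparing two scalar variables, paid in every round and
  once more on exit.\<close>

definition clear_time :: "nat \<Rightarrow> nat" where
  "clear_time n = 5 + n * (5 + com_cost clear_body)"

definition scan_time :: "nat \<Rightarrow> nat" where
  "scan_time n = 5 + n * (5 + com_cost scan_body)"

definition layer_time :: "nat \<Rightarrow> nat" where
  "layer_time n = com_cost scan_init + (scan_time n + com_cost extend)"

definition response_time :: "nat \<Rightarrow> nat" where
  "response_time n = 3 + (clear_time n + (com_cost greedy_init + (5 + n * (5 + layer_time n))))"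

locale oracle_instance = nonneg_ultra_contract "{..<n}" f c
  for n :: nat and f c :: "nat set \<Rightarrow> real"
begin

definition input_ok :: "store \<Rightarrow> bool" where
  "input_ok s \<longleftrightarrow> nats s ''n'' 0 = n \<and> (\<forall>k<n. reals s ''c'' k = c {k})"

definition current :: "store \<Rightarrow> nat set" where
  "current s = {k. k < n \<and> 0 < nats s ''S'' k}"

lemma input_ok_frame:
  assumes "input_ok s" "frame p s s'" "''n'' \<notin> written_nats p" "''c'' \<notin> written_reals p"
  shows "input_ok s'"
  using assms by (simp add: input_ok_def frame_def)

lemma clear_loop:
  assumes "input_ok s" "nats s ''j'' 0 = 0"
  shows "wp n f (While (NLess (nvar ''j'') (nvar ''n'')) clear_body) (clear_time n)
    (\<lambda>s'. current s' = {}) s"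
proof (rule wp_While[where M = n and T = "com_cost clear_body"
      and I = "\<lambda>m s'. nats s' ''j'' 0 + m = n \<and> (\<forall>k<nats s' ''j'' 0. nats s' ''S'' k = 0)"])
  fix m s' assume "nats s' ''j'' 0 + m = n \<and> (\<forall>k<nats s' ''j'' 0. nats s' ''S'' k = 0)"
    and "frame clear_body s s'" and "bval (NLess (nvar ''j'') (nvar ''n'')) s'"
  moreover from this have "input_ok s'"
    using assms input_ok_frame by (auto simp: clear_body_def)
  ultimately show "wp n f clear_body (com_cost clear_body)
     (\<lambda>s''. \<exists>m'<m. nats s'' ''j'' 0 + m' = n \<and> (\<forall>k<nats s'' ''j'' 0. nats s'' ''S'' k = 0)) s'"
    by (intro wp_run exI[of _ "m - 1"]) (auto simp: clear_body_def input_ok_def less_Suc_eq)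
next
  fix m s' assume "nats s' ''j'' 0 + m = n \<and> (\<forall>k<nats s' ''j'' 0. nats s' ''S'' k = 0)"
    and "frame clear_body s s'" and "\<not> bval (NLess (nvar ''j'') (nvar ''n'')) s'"
  moreover from this have "input_ok s'"
    using assms input_ok_frame by (auto simp: clear_body_def)
  ultimately show "current s' = {}" by (auto simp: current_def input_ok_def)
qed (use assms in \<open>auto simp: clear_time_def algebra_simps\<close>)

section \<open>The scan for the best action to add\<close>

definition candidate_utility :: "real \<Rightarrow> nat set \<Rightarrow> nat \<Rightarrow> real" where
  "candidate_utility \<alpha> X k = \<alpha> * f (insert k X) - c {k}"

definition scanned :: "real \<Rightarrow> nat set \<Rightarrow> nat \<Rightarrow> nat \<Rightarrow> real \<Rightarrow> bool" where
  "scanned \<alpha> X j b w \<longleftrightarrow>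
     (if b < n then b \<notin> X \<and> w = f (insert b X) \<and>
         (\<forall>k<j. k \<notin> X \<longrightarrow> candidate_utility \<alpha> X k \<le> candidate_utility \<alpha> X b)
      else \<forall>k<j. k \<in> X)"

lemma scanned_0: "scanned \<alpha> X 0 n w"
  by (simp add: scanned_def)

lemma scanned_skip: "scanned \<alpha> X j b w \<Longrightarrow> j \<in> X \<Longrightarrow> scanned \<alpha> X (Suc j) b w"
  by (auto simp: scanned_def less_Suc_eq)

lemma scanned_keep:
  "scanned \<alpha> X j b w \<Longrightarrow> b < n \<Longrightarrow> \<alpha> * f (insert j X) - c {j} \<le> \<alpha> * w - c {b} \<Longrightarrow>
    scanned \<alpha> X (Suc j) b w"
  by (auto simp: scanned_def candidate_utility_def less_Suc_eq)

lemma scanned_replace: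
  "scanned \<alpha> X j b w \<Longrightarrow> j < n \<Longrightarrow> j \<notin> X \<Longrightarrow>
    (b < n \<Longrightarrow> \<alpha> * w - c {b} < \<alpha> * f (insert j X) - c {j}) \<Longrightarrow>
    scanned \<alpha> X (Suc j) j (f (insert j X))"
  by (auto simp: scanned_def candidate_utility_def less_Suc_eq split: if_splits)

lemma scan_step:
  assumes "input_ok s" "j = nats s ''j'' 0" "j < n"
    and "scanned (reals s ''a'' 0) X j (nats s ''b'' 0) (reals s ''w'' 0)" "current s = X"
  defines "s' \<equiv> run n f scan_body s"
  shows "nats s' ''j'' 0 = Suc j" "current s' = X"
    "scanned (reals s ''a'' 0) X (Suc j) (nats s' ''b'' 0) (reals s' ''w'' 0)"
proof -
  have j: "j \<in> X \<longleftrightarrow> 0 < nats s ''S'' j" using assms(3,5) by (auto simp: current_def)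
  \<comment> \<open>The queried vector is the current set with \<open>j\<close> switched on, written
    in the two shapes that simplification produces.\<close>
  have query: "{k. k < n \<and> 0 < (if k = j then Suc 0 else nats s ''S'' k)} = insert j X"
    "{k. k < n \<and> (k \<noteq> j \<longrightarrow> 0 < nats s ''S'' k)} = insert j X"
    using assms(3,5) by (auto simp: current_def split: if_splits)
  have S: "{k. k < n \<and> 0 < nats s ''S'' k} = X" using assms(5) by (simp add: current_def)
  \<comment> \<open>For \<open>j\<close> outside the set the cell was 0 before, so switching it off
    again restores the array.\<close>
  have upd: "(nats s ''S'')(j := 0) = nats s ''S''" if "j \<notin> X" using j that by auto
  have n: "nats s ''n'' 0 = n" and cj: "reals s ''c'' j = c {j}"
    and cb: "\<And>b. b < n \<Longrightarrow> reals s ''c'' b = c {b}"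
    using assms(1,3) by (auto simp: input_ok_def)
  show "nats s' ''j'' 0 = Suc j"
    using assms(2) unfolding s'_def by (simp add: scan_body_def)
  show "current s' = X"
    using assms(2) j upd S unfolding s'_def current_def by (simp add: scan_body_def)
  show "scanned (reals s ''a'' 0) X (Suc j) (nats s' ''b'' 0) (reals s' ''w'' 0)"
  proof (cases "j \<in> X")
    case True
    then show ?thesis using scanned_skip[OF assms(4)] assms(2) j unfolding s'_def by (simp add: scan_body_def)
  next
    case False
    note rules = scanned_keep[OF assms(4)] scanned_replace[OF assms(4,3) False] assms(2) j False n cj query
    show ?thesis
    proof (cases "nats s ''b'' 0 < n")
      case True
      then show ?thesis
        using rules cb[OF True] unfolding s'_def by (simp add: scan_body_def candidate_value_def not_less)
    next
      case False
      then show ?thesis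
        using rules unfolding s'_def by (simp add: scan_body_def candidate_value_def)
    qed
  qed
qed

lemma scan_loop:
  assumes "input_ok s" "nats s ''j'' 0 = 0" "nats s ''b'' 0 = n" "reals s ''a'' 0 = \<alpha>" "current s = X"
  shows "wp n f (While (NLess (nvar ''j'') (nvar ''n'')) scan_body) (scan_time n)
    (\<lambda>s'. current s' = X \<and> scanned \<alpha> X n (nats s' ''b'' 0) (reals s' ''w'' 0)) s"
proof (rule wp_While[where M = n and T = "com_cost scan_body"
      and I = "\<lambda>m s'. nats s' ''j'' 0 + m = n \<and> current s' = X \<and>
        scanned \<alpha> X (nats s' ''j'' 0) (nats s' ''b'' 0) (reals s' ''w'' 0)"])
  fix m s' assume I: "nats s' ''j'' 0 + m = n \<and> current s' = X \<and>
      scanned \<alpha> X (nats s' ''j'' 0) (nats s' ''b'' 0) (reals s' ''w'' 0)"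
    and fr: "frame scan_body s s'" and b: "bval (NLess (nvar ''j'') (nvar ''n'')) s'"
  have ok: "input_ok s'" "reals s' ''a'' 0 = \<alpha>"
    using input_ok_frame[OF assms(1) fr] frameD[OF fr] assms by (auto simp: scan_body_def)
  have "nats s' ''j'' 0 < n" using ok b by (simp add: input_ok_def)
  then show "wp n f scan_body (com_cost scan_body)
     (\<lambda>s''. \<exists>m'<m. nats s'' ''j'' 0 + m' = n \<and> current s'' = X \<and>
        scanned \<alpha> X (nats s'' ''j'' 0) (nats s'' ''b'' 0) (reals s'' ''w'' 0)) s'"
    using scan_step[OF ok(1) refl, of X] I ok(2)
    by (intro wp_run exI[of _ "m - 1"]) (auto simp: scan_body_def)
next
  fix m s' assume I: "nats s' ''j'' 0 + m = n \<and> current s' = X \<and>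
      scanned \<alpha> X (nats s' ''j'' 0) (nats s' ''b'' 0) (reals s' ''w'' 0)"
    and fr: "frame scan_body s s'" and b: "\<not> bval (NLess (nvar ''j'') (nvar ''n'')) s'"
  have "input_ok s'"
    using input_ok_frame[OF assms(1) fr] by (auto simp: scan_body_def)
  then have "nats s' ''j'' 0 = n" using I b by (simp add: input_ok_def)
  then show "current s' = X \<and> scanned \<alpha> X n (nats s' ''b'' 0) (reals s' ''w'' 0)" using I by simp
qed (use assms in \<open>auto simp: scan_time_def scanned_0 algebra_simps\<close>)

lemma utility_insert:
  assumes "X \<subseteq> {..<n}" "k < n" "k \<notin> X"
  shows "utility \<alpha> (insert k X) = candidate_utility \<alpha> X k - c X"
  using assms cost_insert[of X k] by (simp add: agent_utility_def candidate_utility_def)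

section \<open>Greedy sets and the best of them\<close>

definition best_upto :: "real \<Rightarrow> nat \<Rightarrow> real \<Rightarrow> real \<Rightarrow> bool" where
  "best_upto \<alpha> i F C \<longleftrightarrow>
     (\<exists>Y\<subseteq>{..<n}. F = f Y \<and> C = c Y \<and> (\<forall>Z\<subseteq>{..<n}. card Z \<le> i \<longrightarrow> utility \<alpha> Z \<le> utility \<alpha> Y))"

lemma best_upto_Suc:
  assumes best: "best_upto \<alpha> i F C" and X: "X \<in> layer_demand \<alpha> (Suc i)"
  shows "best_upto \<alpha> (Suc i) (if \<alpha> * F - C < \<alpha> * f X - c X then f X else F)
    (if \<alpha> * F - C < \<alpha> * f X - c X then c X else C)"
proof -
  obtain Y where Y: "Y \<subseteq> {..<n}" "F = f Y" "C = c Y"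
    "\<And>Z. Z \<subseteq> {..<n} \<Longrightarrow> card Z \<le> i \<Longrightarrow> utility \<alpha> Z \<le> utility \<alpha> Y"
    using best by (auto simp: best_upto_def)
  define W where "W = (if \<alpha> * F - C < \<alpha> * f X - c X then X else Y)"
  have W: "utility \<alpha> X \<le> utility \<alpha> W" "utility \<alpha> Y \<le> utility \<alpha> W"
    using Y by (auto simp: W_def agent_utility_def)
  have "utility \<alpha> Z \<le> utility \<alpha> W" if Z: "Z \<subseteq> {..<n}" "card Z \<le> Suc i" for Z
  proof (cases "card Z = Suc i")
    case True
    then show ?thesis using layer_demandD(4)[OF X Z(1)] W(1) by linarith
  next
    case False
    then show ?thesis using Y(4)[OF Z(1)] Z(2) W(2) by linarith
  qed
  moreover have "W \<subseteq> {..<n}" using Y(1) layer_demandD(1)[OF X] by (simp add: W_def)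
  ultimately show ?thesis
    unfolding best_upto_def using Y by (intro exI[of _ W]) (auto simp: W_def)
qed

definition layer_inv :: "real \<Rightarrow> nat \<Rightarrow> store \<Rightarrow> bool" where
  "layer_inv \<alpha> i s \<longleftrightarrow> nats s ''i'' 0 = i \<and> current s \<in> layer_demand \<alpha> i \<and>
     reals s ''k'' 0 = c (current s) \<and> best_upto \<alpha> i (reals s ''F'' 0) (reals s ''C'' 0)"

lemma extend_step:
  assumes ok: "input_ok s" and \<alpha>: "reals s ''a'' 0 = \<alpha>" "0 \<le> \<alpha>"
    and inv: "layer_inv \<alpha> i s" and "i < n"
    and scan: "scanned \<alpha> (current s) n (nats s ''b'' 0) (reals s ''w'' 0)"
  shows "layer_inv \<alpha> (Suc i) (run n f extend s)"
proof -
  define X b where "X = current s" and "b = nats s ''b'' 0"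
  have X: "X \<in> layer_demand \<alpha> i" using inv by (simp add: layer_inv_def X_def)
  note X' = layer_demandD[OF X]
  \<comment> \<open>A scan without a candidate would mean that all \<open>n\<close> actions lie in a
    set of i < n elements.\<close>
  have b: "b < n"
  proof (rule ccontr)
    assume "\<not> b < n"
    then have "{..<n} \<subseteq> X" using scan by (auto simp: scanned_def X_def b_def)
    then have "X = {..<n}" using X' by blast
    then show False using X' \<open>i < n\<close> by simp
  qed
  then have bX: "b \<notin> X" and w: "reals s ''w'' 0 = f (insert b X)"
    and le: "\<And>k. k < n \<Longrightarrow> k \<notin> X \<Longrightarrow> candidate_utility \<alpha> X k \<le> candidate_utility \<alpha> X b"
    using scan by (auto simp: scanned_def X_def b_def)
  have X1: "insert b X \<in> layer_demand \<alpha> (Suc i)"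
    using b bX le X' \<alpha> by (intro greedy_step[OF X]) (auto simp: utility_insert)
  have cX: "c (insert b X) = c X + c {b}" using cost_insert[of X b] X' b bX by simp
  have k: "reals s ''k'' 0 = c X" and best: "best_upto \<alpha> i (reals s ''F'' 0) (reals s ''C'' 0)"
    and i: "nats s ''i'' 0 = i"
    using inv by (auto simp: layer_inv_def X_def)
  have cb: "reals s ''c'' b = c {b}" using ok b by (simp add: input_ok_def)
  have cur: "{k. k < n \<and> (k \<noteq> b \<longrightarrow> 0 < nats s ''S'' k)} = insert b X"
    using b by (auto simp: X_def current_def)
  have cur': "current (run n f extend s) = insert b X"
    using cur b by (auto simp: current_def extend_def b_def)
  show ?thesis
    using best_upto_Suc[OF best X1] X1 w k i cb \<alpha>(1) cX unfolding layer_inv_def cur'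
    by (simp add: extend_def b_def[symmetric] split: if_splits)
qed

lemma layer_step:
  assumes ok: "input_ok s" and \<alpha>: "reals s ''a'' 0 = \<alpha>" "0 \<le> \<alpha>" and inv: "layer_inv \<alpha> i s" and "i < n"
  shows "wp n f layer_body (layer_time n) (layer_inv \<alpha> (Suc i)) s"
  unfolding layer_body_def
proof (rule wp_Seq)
  let ?X = "current s"
  show "wp n f scan_init (com_cost scan_init)
     (\<lambda>s'. nats s' ''j'' 0 = 0 \<and> nats s' ''b'' 0 = n \<and> current s' = ?X \<and> layer_inv \<alpha> i s') s"
    using ok inv by (intro wp_run) (auto simp: scan_init_def input_ok_def layer_inv_def current_def)
  fix s' assume s': "nats s' ''j'' 0 = 0 \<and> nats s' ''b'' 0 = n \<and> current s' = ?X \<and> layer_inv \<alpha> i s'"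
    and fr: "frame scan_init s s'"
  have ok': "input_ok s'" and \<alpha>': "reals s' ''a'' 0 = \<alpha>"
    using input_ok_frame[OF ok fr] frameD[OF fr] \<alpha> by (auto simp: scan_init_def)
  show "wp n f (Seq (While (NLess (nvar ''j'') (nvar ''n'')) scan_body) extend)
      (scan_time n + com_cost extend) (layer_inv \<alpha> (Suc i)) s'"
  proof (rule wp_Seq)
    show "wp n f (While (NLess (nvar ''j'') (nvar ''n'')) scan_body) (scan_time n)
        (\<lambda>s''. current s'' = ?X \<and> scanned \<alpha> ?X n (nats s'' ''b'' 0) (reals s'' ''w'' 0)) s'"
      using s' ok' \<alpha>' by (intro scan_loop) auto
    fix s'' assume s'': "current s'' = ?X \<and> scanned \<alpha> ?X n (nats s'' ''b'' 0) (reals s'' ''w'' 0)"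
      and fr: "frame (While (NLess (nvar ''j'') (nvar ''n'')) scan_body) s' s''"
    have same: "nats s'' ''i'' 0 = nats s' ''i'' 0" "reals s'' ''k'' 0 = reals s' ''k'' 0"
      "reals s'' ''F'' 0 = reals s' ''F'' 0" "reals s'' ''C'' 0 = reals s' ''C'' 0"
      "reals s'' ''a'' 0 = reals s' ''a'' 0"
      using frameD[OF fr] by (simp_all add: scan_body_def)
    have cur: "current s'' = ?X" "current s' = ?X" using s' s'' by blast+
    have ok'': "input_ok s''"
      by (rule input_ok_frame[OF ok' fr]) (simp_all add: scan_body_def)
    have \<alpha>'': "reals s'' ''a'' 0 = \<alpha>" using same(5) \<alpha>' by (rule trans)
    have inv': "layer_inv \<alpha> i s'" using s' by blast
    then have inv'': "layer_inv \<alpha> i s''" unfolding layer_inv_def same cur .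
    have scan: "scanned \<alpha> (current s'') n (nats s'' ''b'' 0) (reals s'' ''w'' 0)"
      using s'' unfolding cur by (rule conjunct2)
    show "wp n f extend (com_cost extend) (layer_inv \<alpha> (Suc i)) s''"
    proof (rule wp_run)
      show "layer_inv \<alpha> (Suc i) (run n f extend s'')"
        by (rule extend_step[OF ok'' \<alpha>'' \<alpha>(2) inv'' \<open>i < n\<close> scan])
    qed (simp_all add: extend_def)
  qed simp
qed (simp add: layer_time_def)

lemma layer_loop:
  assumes ok: "input_ok s" and \<alpha>: "reals s ''a'' 0 = \<alpha>" "0 \<le> \<alpha>" and inv: "layer_inv \<alpha> 0 s"
  shows "wp n f (While (NLess (nvar ''i'') (nvar ''n'')) layer_body) (5 + n * (5 + layer_time n))
    (\<lambda>s'. \<exists>Y\<in>demand {..<n} f c \<alpha>. reals s' ''F'' 0 = f Y \<and> reals s' ''C'' 0 = c Y) s"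
proof (rule wp_While[where M = n and T = "layer_time n"
      and I = "\<lambda>m s'. nats s' ''i'' 0 + m = n \<and> layer_inv \<alpha> (nats s' ''i'' 0) s'"])
  show "nats s ''i'' 0 + n = n \<and> layer_inv \<alpha> (nats s ''i'' 0) s"
    using inv by (auto simp: layer_inv_def)
  have layer_body_writes: "''n'' \<notin> written_nats layer_body" "''c'' \<notin> written_reals layer_body"
      "''a'' \<notin> written_reals layer_body"
    by (auto simp: layer_body_def scan_init_def scan_body_def extend_def)
  fix m s' assume I: "nats s' ''i'' 0 + m = n \<and> layer_inv \<alpha> (nats s' ''i'' 0) s'"
    and fr: "frame layer_body s s'"
  have ok': "input_ok s'" and \<alpha>': "reals s' ''a'' 0 = \<alpha>"
    using input_ok_frame[OF ok fr] frameD[OF fr] \<alpha> layer_body_writes by auto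
  show "wp n f layer_body (layer_time n)
      (\<lambda>s''. \<exists>m'<m. nats s'' ''i'' 0 + m' = n \<and> layer_inv \<alpha> (nats s'' ''i'' 0) s'') s'"
    if "bval (NLess (nvar ''i'') (nvar ''n'')) s'"
  proof (rule wp_frame)
    have i: "nats s' ''i'' 0 < n" using that ok' by (simp add: input_ok_def)
    then show "wp n f layer_body (layer_time n) (layer_inv \<alpha> (Suc (nats s' ''i'' 0))) s'"
      using I ok' \<alpha>' \<alpha>(2) by (intro layer_step) auto
    fix s'' assume "layer_inv \<alpha> (Suc (nats s' ''i'' 0)) s''"
    then show "\<exists>m'<m. nats s'' ''i'' 0 + m' = n \<and> layer_inv \<alpha> (nats s'' ''i'' 0) s''"
      using I i by (intro exI[of _ "m - 1"]) (auto simp: layer_inv_def)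
  qed
  show "\<exists>Y\<in>demand {..<n} f c \<alpha>. reals s' ''F'' 0 = f Y \<and> reals s' ''C'' 0 = c Y"
    if "\<not> bval (NLess (nvar ''i'') (nvar ''n'')) s'"
  proof -
    have "nats s' ''i'' 0 = n" using that ok' I by (simp add: input_ok_def)
    then have "best_upto \<alpha> n (reals s' ''F'' 0) (reals s' ''C'' 0)"
      using I by (simp add: layer_inv_def)
    moreover have "card Z \<le> n" if "Z \<subseteq> {..<n}" for Z
      using card_mono[OF _ that] by simp
    ultimately show ?thesis by (auto simp: best_upto_def demand_iff)
  qed
qed (auto simp: algebra_simps)

lemma empty_layer: "{} \<in> layer_demand \<alpha> 0"
  by (rule layer_demandI) (use finite_subset[OF _ finite_A] in \<open>auto simp: card_eq_0_iff\<close>)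

lemma best_upto_0: "best_upto \<alpha> 0 0 0"
  unfolding best_upto_def
  by (intro exI[of _ "{}"]) (use finite_subset[OF _ finite_A] in \<open>auto simp: f_empty\<close>)

text \<open>Ties are left open: the result is some demanded set, not necessarily one of maximal
  reward. The search asks for no more, and uses only the reward and the cost of that set.\<close>

lemma best_response_correct:
  assumes ok: "input_ok s" and \<alpha>: "reals s ''a'' 0 = \<alpha>" "0 \<le> \<alpha>"
  shows "wp n f best_response (response_time n)
    (\<lambda>s'. \<exists>Y\<in>demand {..<n} f c \<alpha>. reals s' ''F'' 0 = f Y \<and> reals s' ''C'' 0 = c Y) s"
    (is "wp _ _ _ _ ?Q s")
  unfolding best_response_def
proof (rule wp_Seq)
  let ?clear = "While (NLess (nvar ''j'') (nvar ''n'')) clear_body"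
  let ?layers = "While (NLess (nvar ''i'') (nvar ''n'')) layer_body"
  show "wp n f (nset ''j'' (NConst 0)) 3 (\<lambda>s'. nats s' ''j'' 0 = 0) s"
    by (intro wp_run) auto
  fix s' assume s': "nats s' ''j'' 0 = 0" and fr: "frame (nset ''j'' (NConst 0)) s s'"
  have ok': "input_ok s'" and \<alpha>': "reals s' ''a'' 0 = \<alpha>"
    using input_ok_frame[OF ok fr] frameD[OF fr] \<alpha> by auto
  show "wp n f (Seq ?clear (Seq greedy_init ?layers))
     (clear_time n + (com_cost greedy_init + (5 + n * (5 + layer_time n)))) ?Q s'"
  proof (rule wp_Seq[OF clear_loop[OF ok' s']])
    fix s'' assume s'': "current s'' = {}" and fr: "frame ?clear s' s''"
    have ok'': "input_ok s''" and \<alpha>'': "reals s'' ''a'' 0 = \<alpha>"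
      using input_ok_frame[OF ok' fr] frameD[OF fr] \<alpha>' by (auto simp: clear_body_def)
    show "wp n f (Seq greedy_init ?layers) (com_cost greedy_init + (5 + n * (5 + layer_time n))) ?Q s''"
    proof (rule wp_Seq)
      have "current (run n f greedy_init s'') = {}"
        using s'' by (simp add: current_def greedy_init_def)
      then have "layer_inv \<alpha> 0 (run n f greedy_init s'')"
        using empty_layer best_upto_0 by (simp add: layer_inv_def greedy_init_def)
      then show "wp n f greedy_init (com_cost greedy_init) (layer_inv \<alpha> 0) s''"
        by (intro wp_run) (simp_all add: greedy_init_def)
      fix s3 assume s3: "layer_inv \<alpha> 0 s3" and fr: "frame greedy_init s'' s3"
      show "wp n f ?layers (5 + n * (5 + layer_time n)) ?Q s3"
        using input_ok_frame[OF ok'' fr] frameD[OF fr] \<alpha>'' \<alpha>(2) s3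
        by (intro layer_loop) (auto simp: greedy_init_def)
    qed simp
  qed simp
qed (simp add: response_time_def)

end

section \<open>Correctness of the program\<close>

definition slope_bound :: "nat \<Rightarrow> nat" where
  "slope_bound n = Suc n * Suc (n * n)"

definition init_time :: nat where
  "init_time = com_cost (Cond (RLess RZero (rvar ''F'')) push Skip)"

definition step_time :: "nat \<Rightarrow> nat" where
  "step_time n = com_cost cross + (response_time n + com_cost update)"

text \<open>The 3 pays for setting \<open>a\<close> to 1, each 4 for a test of the outer loop, and
  \<open>2 * slope_bound n\<close> bounds the initial variant.\<close>

definition contract_time :: "nat \<Rightarrow> nat" where
  "contract_time n =
     3 + (response_time n + (init_time + (4 + 2 * slope_bound n * (4 + step_time n))))"

context oracle_instance
begin

text \<open>The top of the stack is the head of the list but the last used array index, hence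
  \<open>rev\<close>. The contracts paired with the sets are not stored; they exist only in the
  proof.\<close>

definition stored :: "real \<times> nat set \<Rightarrow> (real \<times> nat set) list \<Rightarrow> store \<Rightarrow> bool" where
  "stored p stk s \<longleftrightarrow> nats s ''m'' 0 = length stk \<and>
     reals s ''LF'' 0 = f (snd p) \<and> reals s ''LC'' 0 = c (snd p) \<and>
     (\<forall>i<length stk. reals s ''TF'' i = f (snd (rev stk ! i)) \<and> reals s ''TC'' i = c (snd (rev stk ! i)))"

definition search_store ::
  "(real \<times> nat set) list \<Rightarrow> real \<times> nat set \<Rightarrow> (real \<times> nat set) list \<Rightarrow> store \<Rightarrow> bool" where
  "search_store us p stk s \<longleftrightarrow>
     search_state us p stk (reals s ''best'' 0) (reals s ''alpha'' 0) \<and> stored p stk s"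

text \<open>A push lengthens the chain by one and a pop shortens the stack by one.\<close>

definition main_inv :: "nat \<Rightarrow> store \<Rightarrow> bool" where
  "main_inv k s \<longleftrightarrow> (\<exists>us p stk. search_store us p stk s \<and>
     k + 2 * length (us @ p # stk) = 2 * slope_bound n + length stk)"

lemma search_state_length:
  "search_state us p stk r \<alpha> \<Longrightarrow> length (us @ p # stk) \<le> slope_bound n"
  using slope_chain_length[of "us @ p # stk"] by (simp add: search_state_def slope_bound_def)

text \<open>A push also raises the stack, so the chain is weighted by 2 to leave a net decrease of
  one; a pop keeps the chain length. The bound on the chain prevents the subtraction that defines
  the new variant from being truncated.\<close>

lemma main_invI:
  assumes "search_store us p stk s"
    and "2 * slope_bound n + length stk < k + 2 * length (us @ p # stk)"
  shows "\<exists>k'<k. main_inv k' s"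
proof -
  have "length (us @ p # stk) \<le> slope_bound n"
    using assms(1) search_state_length unfolding search_store_def by blast
  then have len: "2 * length (us @ p # stk) \<le> 2 * slope_bound n" by (rule mult_le_mono2)
  let ?k = "2 * slope_bound n + length stk - 2 * length (us @ p # stk)"
  have "?k < k" using assms(2) len by linarith
  moreover have "?k + 2 * length (us @ p # stk) = 2 * slope_bound n + length stk" using len by linarith
  then have "main_inv ?k s" using assms(1) unfolding main_inv_def by blast
  ultimately show ?thesis by blast
qed

lemma stored_top:
  assumes "stored p (q # stk) s"
  shows "reals s ''TF'' (length stk) = f (snd q)" "reals s ''TC'' (length stk) = c (snd q)"
  using assms by (auto simp: stored_def nth_append dest: spec[of _ "length stk"])

lemma stored_push:
  assumes "stored p stk s" "reals s ''F'' 0 = f Y" "reals s ''C'' 0 = c Y"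
  shows "stored p ((\<gamma>, Y) # stk) (run n f push s)"
  using assms by (auto simp: stored_def push_def nth_append)

lemma stored_pop:
  assumes "stored p (q # stk) s"
  shows "stored q stk (run n f pop s)"
proof -
  have "nats s ''m'' 0 = Suc (length stk)" using assms by (simp add: stored_def)
  moreover have "reals s ''TF'' i = f (snd (rev stk ! i)) \<and> reals s ''TC'' i = c (snd (rev stk ! i))"
    if "i < length stk" for i
    using assms that by (auto simp: stored_def nth_append dest: spec[of _ i])
  ultimately show ?thesis using stored_top[OF assms] by (simp add: stored_def pop_def)
qed

lemma update_step:
  assumes inv: "search_store us p (q # stk) s" and \<gamma>: "\<gamma> = crossing (snd p) (snd q)"
    and a: "reals s ''a'' 0 = \<gamma>" and Y: "Y \<in> demand {..<n} f c \<gamma>"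
    and FC: "reals s ''F'' 0 = f Y" "reals s ''C'' 0 = c Y"
    and k: "k + 2 * length (us @ p # q # stk) = 2 * slope_bound n + length (q # stk)"
  shows "\<exists>k'<k. main_inv k' (run n f update s)"
proof -
  have st: "search_state us p (q # stk) (reals s ''best'' 0) (reals s ''alpha'' 0)"
    and sto: "stored p (q # stk) s" using inv by (auto simp: search_store_def)
  have LF: "reals s ''LF'' 0 = f (snd p)" "reals s ''LC'' 0 = c (snd p)"
    and m: "nats s ''m'' 0 = Suc (length stk)"
    using sto by (auto simp: stored_def)
  show ?thesis
  proof (cases "utility \<gamma> (snd p) < utility \<gamma> Y")
    case True
    then have run: "run n f update s = run n f push s"
      using a FC LF by (simp add: update_def agent_utility_def)
    have "search_store us p ((\<gamma>, Y) # q # stk) (run n f push s)"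
      using search_push[OF st \<gamma> Y True] stored_push[OF sto FC] by (simp add: search_store_def push_def)
    then show ?thesis unfolding run using k by (intro main_invI) auto
  next
    case False
    then have run: "run n f update s = run n f pop s"
      using a FC LF by (simp add: update_def agent_utility_def)
    let ?r = "(1 - \<gamma>) * f (snd q)"
    have "reals (run n f pop s) ''best'' 0 = max (reals s ''best'' 0) ?r"
      "reals (run n f pop s) ''alpha'' 0 = (if reals s ''best'' 0 < ?r then \<gamma> else reals s ''alpha'' 0)"
      using stored_top[OF sto] m a by (simp_all add: pop_def)
    then have "search_store (us @ [p]) q stk (run n f pop s)"
      using search_pop[OF st \<gamma> Y _ refl] False stored_pop[OF sto] by (simp add: search_store_def)
    then show ?thesis unfolding run using k by (intro main_invI) auto
  qed
qed

lemma cross_run: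
  assumes "stored p (q # stk) s"
  shows "reals (run n f cross s) ''a'' 0 = crossing (snd p) (snd q)"
proof -
  have "nats s ''m'' 0 = Suc (length stk)" "reals s ''LF'' 0 = f (snd p)" "reals s ''LC'' 0 = c (snd p)"
    using assms by (auto simp: stored_def)
  then show ?thesis using stored_top[OF assms] by (simp add: cross_def crossing_def)
qed

lemma best_response_writes:
  "x \<notin> {''i'', ''j'', ''b'', ''S''} \<Longrightarrow> x \<notin> written_nats best_response"
  "x \<notin> {''k'', ''v'', ''w'', ''F'', ''C''} \<Longrightarrow> x \<notin> written_reals best_response"
  by (auto simp: best_response_def clear_body_def greedy_init_def layer_body_def scan_init_def
      scan_body_def extend_def)

lemma search_store_cong:
  assumes "search_store us p stk s" "nats s' ''m'' = nats s ''m''"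
    "\<And>x. x \<in> {''best'', ''alpha'', ''LF'', ''LC'', ''TF'', ''TC''} \<Longrightarrow> reals s' x = reals s x"
  shows "search_store us p stk s'"
  using assms by (simp add: search_store_def stored_def)

lemma main_step:
  assumes ok: "input_ok s" and inv: "main_inv k s" and m: "0 < nats s ''m'' 0"
  shows "wp n f (Seq cross (Seq best_response update)) (step_time n) (\<lambda>s'. \<exists>k'<k. main_inv k' s') s"
proof -
  obtain us p stk0 where st0: "search_store us p stk0 s"
    "k + 2 * length (us @ p # stk0) = 2 * slope_bound n + length stk0"
    using inv by (auto simp: main_inv_def)
  then obtain q stk where stk0: "stk0 = q # stk"
    using m by (cases stk0) (auto simp: search_store_def stored_def)
  note st = st0[unfolded stk0]
  define \<gamma> where "\<gamma> = crossing (snd p) (snd q)"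
  have "search_state us p (q # stk) (reals s ''best'' 0) (reals s ''alpha'' 0)"
    and sto: "stored p (q # stk) s"
    using st(1) by (auto simp: search_store_def)
  from search_stateD(4,6)[OF this(1)] have \<gamma>0: "0 \<le> \<gamma>" by (simp add: \<gamma>_def)
  show ?thesis
  proof (rule wp_Seq)
    show "wp n f cross (com_cost cross) (\<lambda>s'. reals s' ''a'' 0 = \<gamma>) s"
    proof (rule wp_run)
      show "reals (run n f cross s) ''a'' 0 = \<gamma>" unfolding \<gamma>_def by (rule cross_run[OF sto])
    qed (simp_all add: cross_def)
    fix s' assume a: "reals s' ''a'' 0 = \<gamma>" and fr: "frame cross s s'"
    have ok': "input_ok s'" by (rule input_ok_frame[OF ok fr]) (simp_all add: cross_def)
    have st': "search_store us p (q # stk) s'"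
      by (rule search_store_cong[OF st(1)]) (auto intro!: frameD[OF fr] simp: cross_def)
    show "wp n f (Seq best_response update) (response_time n + com_cost update)
        (\<lambda>s''. \<exists>k'<k. main_inv k' s'') s'"
    proof (rule wp_Seq[OF best_response_correct[OF ok' a \<gamma>0]])
      fix s'' assume "\<exists>Y\<in>demand {..<n} f c \<gamma>. reals s'' ''F'' 0 = f Y \<and> reals s'' ''C'' 0 = c Y"
        and fr: "frame best_response s' s''"
      then obtain Y where Y: "Y \<in> demand {..<n} f c \<gamma>" "reals s'' ''F'' 0 = f Y" "reals s'' ''C'' 0 = c Y"
        by blast
      have st'': "search_store us p (q # stk) s''"
        by (rule search_store_cong[OF st']) (auto intro!: frameD[OF fr] best_response_writes)
      have "reals s'' ''a'' = reals s' ''a''"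
        by (intro frameD[OF fr] best_response_writes) simp
      then have a': "reals s'' ''a'' 0 = \<gamma>" using a by simp
      show "wp n f update (com_cost update) (\<lambda>s''. \<exists>k'<k. main_inv k' s'') s''"
        by (rule wp_run[where Q = "\<lambda>s''. \<exists>k'<k. main_inv k' s''",
              OF _ update_step[OF st'' \<gamma>_def a' Y st(2)]])
          (simp_all add: update_def push_def pop_def)
    qed simp
  qed (simp add: step_time_def)
qed

lemma contract_program_correct:
  "wp n f contract_program (contract_time n)
     (\<lambda>s. optimal_contract {..<n} f c (output_value s)) (input_store n c)"
    (is "wp _ _ _ _ ?Q ?s")
  unfolding contract_program_def
proof (rule wp_Seq)
  let ?start = "Cond (RLess RZero (rvar ''F'')) push Skip"
  let ?step = "Seq cross (Seq best_response update)"
  let ?loop = "While (NLess (NConst 0) (nvar ''m'')) ?step"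
  let ?zero = "\<lambda>s. nats s ''m'' 0 = 0 \<and> (\<forall>x\<in>{''best'', ''alpha'', ''LF'', ''LC''}. reals s x 0 = 0)"
  show "wp n f (rset ''a'' ROne) 3 (\<lambda>s. reals s ''a'' 0 = 1 \<and> input_ok s \<and> ?zero s) ?s"
    by (intro wp_run) (auto simp: input_store_def input_ok_def)
  fix s assume s: "reals s ''a'' 0 = 1 \<and> input_ok s \<and> ?zero s"
  then have ok: "input_ok s" and a: "reals s ''a'' 0 = 1" by auto
  show "wp n f (Seq best_response (Seq ?start ?loop))
     (response_time n + (init_time + (4 + 2 * slope_bound n * (4 + step_time n)))) ?Q s"
  proof (rule wp_Seq[OF best_response_correct[OF ok a]])
    fix s' assume "\<exists>Y\<in>demand {..<n} f c 1. reals s' ''F'' 0 = f Y \<and> reals s' ''C'' 0 = c Y"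
      and fr: "frame best_response s s'"
    then obtain Y where Y: "Y \<in> demand {..<n} f c 1" and FC: "reals s' ''F'' 0 = f Y" "reals s' ''C'' 0 = c Y"
      by blast
    have ok': "input_ok s'" by (rule input_ok_frame[OF ok fr]) (auto intro!: best_response_writes)
    have "nats s' ''m'' = nats s ''m''" by (intro frameD[OF fr] best_response_writes) simp
    moreover have "reals s' x = reals s x" if "x \<in> {''best'', ''alpha'', ''LF'', ''LC''}" for x
      using that by (intro frameD[OF fr] best_response_writes) auto
    ultimately have z: "?zero s'" using s by auto
    \<comment> \<open>The cells \<open>m\<close>, \<open>LF\<close> and \<open>LC\<close> are still
      0, which already encodes the line of the empty set with an empty stack.\<close>
    then have sto: "stored (0, {}) [] s'" using f_empty by (simp add: stored_def)
    show "wp n f (Seq ?start ?loop) (init_time + (4 + 2 * slope_bound n * (4 + step_time n))) ?Q s'"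
    proof (rule wp_Seq)
      let ?I = "\<lambda>s. \<exists>k\<le>2 * slope_bound n. main_inv k s"
      \<comment> \<open>The successor turns the strict bound from \<open>main_invI\<close> into the
        non-strict one that the loop rule takes.\<close>
      have "\<exists>k<Suc (2 * slope_bound n). main_inv k (run n f ?start s')"
      proof (cases "0 < f Y")
        case True
        have "search_store [] (0, {}) [(1, Y)] (run n f push s')"
          using search_init(1)[OF Y True] stored_push[OF sto FC] z
          by (simp add: search_store_def push_def)
        then show ?thesis using True FC by (intro main_invI) auto
      next
        case False
        then have "search_store [] (0, {}) [] s'"
          using search_init(2)[OF Y] sto z by (simp add: search_store_def)
        then show ?thesis using False FC by (intro main_invI) auto
      qed
      then show "wp n f ?start init_time ?I s'"
        by (intro wp_run) (auto simp: init_time_def push_def less_Suc_eq_le)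
      fix s1 assume "?I s1" and fr: "frame ?start s' s1"
      then obtain k where k: "k \<le> 2 * slope_bound n" "main_inv k s1" by blast
      have ok1: "input_ok s1" by (rule input_ok_frame[OF ok' fr]) (simp_all add: push_def)
      show "wp n f ?loop (4 + 2 * slope_bound n * (4 + step_time n)) ?Q s1"
      proof (rule wp_While[where I = main_inv, OF k(2,1)])
        fix k' s2 assume inv: "main_inv k' s2" and fr: "frame ?step s1 s2"
        have ok2: "input_ok s2"
          by (rule input_ok_frame[OF ok1 fr])
            (auto simp: cross_def update_def push_def pop_def best_response_writes)
        show "wp n f ?step (step_time n) (\<lambda>s. \<exists>m'<k'. main_inv m' s) s2"
          if "bval (NLess (NConst 0) (nvar ''m'')) s2"
          using that by (intro main_step[OF ok2 inv]) simp
        show "?Q s2" if "\<not> bval (NLess (NConst 0) (nvar ''m'')) s2"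
        proof -
          obtain us p stk where st: "search_store us p stk s2" using inv by (auto simp: main_inv_def)
          then have "stk = []" using that by (simp add: search_store_def stored_def)
          then have "search_state us p [] (reals s2 ''best'' 0) (reals s2 ''alpha'' 0)"
            using st by (simp add: search_store_def)
          from search_final[OF this] show ?thesis by (simp add: output_value_def)
        qed
      qed (simp add: algebra_simps)
    qed simp
  qed simp_all
qed (simp add: contract_time_def)

end

lemma contract_time_poly: "\<exists>q :: nat poly. \<forall>n. poly q n = contract_time n"
proof -
  define x :: "nat poly" where "x = [:0, 1:]"
  define layer where "layer = [:com_cost scan_init:] + ([:5:] + x * [:5 + com_cost scan_body:] + [:com_cost extend:])"
  define response where "response = [:3:] + ([:5:] + x * [:5 + com_cost clear_body:] +
    ([:com_cost greedy_init:] + ([:5:] + x * ([:5:] + layer))))"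
  define step where "step = [:com_cost cross:] + (response + [:com_cost update:])"
  have "poly layer n = layer_time n" for n
    by (simp add: layer_def x_def layer_time_def scan_time_def)
  then have response: "poly response n = response_time n" for n
    by (simp add: response_def x_def response_time_def clear_time_def algebra_simps)
  then have step: "poly step n = step_time n" for n
    by (simp add: step_def step_time_def)
  have "poly ([:3:] + (response + ([:init_time:] + ([:4:] +
      [:2:] * ((x + 1) * (x * x + 1)) * ([:4:] + step))))) n = contract_time n" for n
    using response step by (simp add: contract_time_def slope_bound_def x_def)
  then show ?thesis by blast
qed

theorem theorem1:
  "\<exists>(p :: com) (q :: nat poly). \<forall>(n :: nat) (f :: nat set \<Rightarrow> real) (c :: nat set \<Rightarrow> real).
     nonneg_set_function {..<n} f \<and> f {} = 0 \<and> mono_on (Pow {..<n}) f \<and> ultra {..<n} f \<and>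
     nonneg_set_function {..<n} c \<and> additive_set_function {..<n} c \<longrightarrow>
     (\<exists>t s. exec n f p (input_store n c) t s \<and> t \<le> poly q n \<and>
        optimal_contract {..<n} f c (output_value s))"
proof -
  obtain q :: "nat poly" where q: "\<And>n. poly q n = contract_time n" using contract_time_poly by blast
  show ?thesis
  proof (rule exI[of _ contract_program], rule exI[of _ q], intro allI impI)
    fix n :: nat and f c :: "nat set \<Rightarrow> real"
    assume *: "nonneg_set_function {..<n} f \<and> f {} = 0 \<and> mono_on (Pow {..<n}) f \<and> ultra {..<n} f \<and>
      nonneg_set_function {..<n} c \<and> additive_set_function {..<n} c"
    interpret oracle_instance n f c
      by unfold_locales (use * in auto)
    show "\<exists>t s. exec n f contract_program (input_store n c) t s \<and> t \<le> poly q n \<and>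
        optimal_contract {..<n} f c (output_value s)"
      using contract_program_correct by (simp add: wp_def q)
  qed
qed

end
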